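(* Let $\delta>0$, $\varepsilon>0$, $\zeta_l>0$, $w_l\in\mathbb{R}$ and $s>0$ be given constants with $s>\sqrt{\zeta_l}+w_l/\zeta_l$. Then there is a unique (up to translations $\xi\mapsto\xi+\xi_0$ of the independent variable) global solution $(z,v)$, defined for all $\xi\in\mathbb{R}$, of the system $$z'=v,\qquad v'=-\frac{3}{K_1^2}F(e^z)-\frac{3c}{K_1^2}v,$$ whose orbit in the phase plane is bounded and contained in $$\mathcal{M}=\{(z,v)\in\mathbb{R}^2:\ z_l<z<\ln(K_1^2/\zeta_l^2)\},$$ and which tends to $(z_l,0)$ as $\xi\to-\infty$ and to $(z_r,0)$ as $\xi\to+\infty$, where the states satisfy the Lax condition $$\frac{w_l}{\zeta_l}+\sqrt{\zeta_l}<s<\frac{w_r}{\zeta_r}+\sqrt{\zeta_r}.$$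
   Context: Notation: $'=d/d\xi$; $c=s\varepsilon/\sqrt{\delta}$; $K_1=w_l-s\zeta_l$ (which is negative since $s>\sqrt{\zeta_l}+w_l/\zeta_l$); $K_2=-sw_l+\frac{\zeta_l^2}{2}+\frac{w_l^2}{\zeta_l}$, so that $K_2-sK_1=\frac{K_1^2}{\zeta_l}+\frac{\zeta_l^2}{2}$. For $\zeta>0$, $$F(\zeta)=\frac{\zeta}{2}+\frac{K_1^2}{\zeta^2}-\frac{K_2-sK_1}{\zeta}=\frac{(\zeta-\zeta_l)(\zeta-\zeta_r)(\zeta+\zeta_l+\zeta_r)}{2\zeta^2},$$ where $$\zeta_r=-\frac{\zeta_l}{2}+\frac12\sqrt{\frac{8K_1^2+\zeta_l^3}{\zeta_l}},\qquad w_r=s\zeta_r+K_1 .$$ Finally $z_l=\ln\zeta_l$ and $z_r=\ln\zeta_r$. *)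

theory Defs
  imports "HOL-Analysis.Analysis"
begin

definition c_const :: "real \<Rightarrow> real \<Rightarrow> real \<Rightarrow> real" where
  "c_const \<delta> \<epsilon> s = s * \<epsilon> / sqrt \<delta>"

definition K1 :: "real \<Rightarrow> real \<Rightarrow> real \<Rightarrow> real" where
  "K1 s \<zeta>l wl = wl - s * \<zeta>l"

definition K2 :: "real \<Rightarrow> real \<Rightarrow> real \<Rightarrow> real" where
  "K2 s \<zeta>l wl = - s * wl + \<zeta>l\<^sup>2 / 2 + wl\<^sup>2 / \<zeta>l"

text \<open>Only the values at positive \<open>\<zeta>\<close> are meaningful; below, \<open>F\<close> is evaluated at \<open>exp z\<close> only.\<close>

definition F :: "real \<Rightarrow> real \<Rightarrow> real \<Rightarrow> real \<Rightarrow> real" where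
  "F s \<zeta>l wl \<zeta> =
     \<zeta> / 2 + (K1 s \<zeta>l wl)\<^sup>2 / \<zeta>\<^sup>2 - (K2 s \<zeta>l wl - s * K1 s \<zeta>l wl) / \<zeta>"

definition \<zeta>r :: "real \<Rightarrow> real \<Rightarrow> real \<Rightarrow> real" where
  "\<zeta>r s \<zeta>l wl = - \<zeta>l / 2 + 1 / 2 * sqrt ((8 * (K1 s \<zeta>l wl)\<^sup>2 + \<zeta>l ^ 3) / \<zeta>l)"

definition wr :: "real \<Rightarrow> real \<Rightarrow> real \<Rightarrow> real" where
  "wr s \<zeta>l wl = s * \<zeta>r s \<zeta>l wl + K1 s \<zeta>l wl"

definition M :: "real \<Rightarrow> real \<Rightarrow> real \<Rightarrow> (real \<times> real) set" where
  "M s \<zeta>l wl = {(z, v). ln \<zeta>l < z \<and> z < ln ((K1 s \<zeta>l wl)\<^sup>2 / \<zeta>l\<^sup>2)}"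

definition global_solution ::
  "real \<Rightarrow> real \<Rightarrow> real \<Rightarrow> real \<Rightarrow> real \<Rightarrow> (real \<Rightarrow> real) \<Rightarrow> (real \<Rightarrow> real) \<Rightarrow> bool" where
  "global_solution \<delta> \<epsilon> s \<zeta>l wl z v \<longleftrightarrow>
     (\<forall>\<xi>. (z has_real_derivative v \<xi>) (at \<xi>) \<and>
          (v has_real_derivative
             (- (3 / (K1 s \<zeta>l wl)\<^sup>2) * F s \<zeta>l wl (exp (z \<xi>))
              - 3 * c_const \<delta> \<epsilon> s / (K1 s \<zeta>l wl)\<^sup>2 * v \<xi>)) (at \<xi>))"

definition connecting_solution ::
  "real \<Rightarrow> real \<Rightarrow> real \<Rightarrow> real \<Rightarrow> real \<Rightarrow> (real \<Rightarrow> real) \<Rightarrow> (real \<Rightarrow> real) \<Rightarrow> bool" where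
  "connecting_solution \<delta> \<epsilon> s \<zeta>l wl z v \<longleftrightarrow>
     global_solution \<delta> \<epsilon> s \<zeta>l wl z v \<and>
     bounded (range (\<lambda>\<xi>. (z \<xi>, v \<xi>))) \<and>
     range (\<lambda>\<xi>. (z \<xi>, v \<xi>)) \<subseteq> M s \<zeta>l wl \<and>
     ((\<lambda>\<xi>. (z \<xi>, v \<xi>)) \<longlongrightarrow> (ln \<zeta>l, 0)) at_bot \<and>
     ((\<lambda>\<xi>. (z \<xi>, v \<xi>)) \<longlongrightarrow> (ln (\<zeta>r s \<zeta>l wl), 0)) at_top"

end

theory Submission
  imports Defs
begin

text \<open>The equation is that of a damped particle in the potential \<open>G\<close> with \<open>G' = g = 3 F(e\<^sup>z) / K1\<^sup>2\<close>:
  \<open>z\<^sub>l\<close> is a saddle, \<open>z\<^sub>r\<close> is the bottom of the well, and \<open>m = ln (K1\<^sup>2 / \<zeta>l\<^sup>2)\<close> is the point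
  beyond the well where \<open>G\<close> regains its value at \<open>z\<^sub>l\<close>. Outside \<open>[z\<^sub>l, m]\<close> the force is
  replaced by a constant, which makes the vector field globally Lipschitz.

  Existence: a shooting argument yields an orbit that comes out of the saddle into the well. Its energy
  \<open>v\<^sup>2 / 2 + G(z)\<close> decreases and hence stays below \<open>G(z\<^sub>l) = G(m)\<close>, so the orbit cannot leave
  \<open>(z\<^sub>l, m)\<close>, and by LaSalle's principle it converges to the bottom of the well.
  Uniqueness: the force has negative slope at the saddle. If two orbits coming out of the saddle
  are shifted in time so that they meet near it, then their difference satisfies a maximum principle
  on the past half line and thus vanishes there.\<close>

section \<open>Lipschitz differential equations\<close>

lemma integral_has_vector_derivative_atLeast:
  fixes h :: "real \<Rightarrow> 'a::banach"
  assumes "continuous_on UNIV h" "0 \<le> t"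
  shows "((\<lambda>t. integral {0..t} h) has_vector_derivative h t) (at t within {0..})"
proof -
  have "((\<lambda>t. integral {0..t} h) has_vector_derivative h t) (at t within {0..t+1})"
    using assms by (intro integral_has_vector_derivative) (auto intro: continuous_on_subset)
  moreover have "at t within {0..} = at t within {0..t+1}"
    using assms by (intro at_within_nhd[where S="{..<t+1}"]) auto
  ultimately show ?thesis by simp
qed

lemma continuous_on_integral_atLeast:
  fixes h :: "real \<Rightarrow> 'a::banach"
  assumes "continuous_on UNIV h"
  shows "continuous_on {0..} (\<lambda>t. integral {0..t} h)"
  unfolding continuous_on_eq_continuous_within
  using integral_has_vector_derivative_atLeast[OF assms] has_vector_derivative_continuous by fastforce

text \<open>Integrating the weight \<open>exp (K * s)\<close> gains a factor \<open>1 / K\<close>.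
  Against the Lipschitz constant \<open>L\<close> of the field, \<open>K = 2 * L\<close> therefore
  gives the contraction factor 1/2.\<close>

lemma norm_integral_exp_bound:
  fixes h :: "real \<Rightarrow> 'a::banach"
  assumes h: "continuous_on UNIV h" and "0 < K" "0 \<le> T" "0 \<le> C"
    and bound: "\<And>s. 0 \<le> s \<Longrightarrow> norm (h s) \<le> C * exp (K * s)"
  shows "norm (integral {0..T} h) \<le> C / K * exp (K * T)"
proof -
  have I: "((\<lambda>s. C * exp (K * s)) has_integral C / K * exp (K * T) - C / K * exp (K * 0)) {0..T}"
    using \<open>0 < K\<close> \<open>0 \<le> T\<close>
    by (intro fundamental_theorem_of_calculus)
      (auto intro!: derivative_eq_intros simp: has_real_derivative_iff_has_vector_derivative[symmetric])
  have "norm (integral {0..T} h) \<le> integral {0..T} (\<lambda>s. C * exp (K * s))"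
    using I h by (intro integral_norm_bound_integral integrable_continuous_real bound)
      (auto intro: continuous_on_subset
        intro!: continuous_on_mult continuous_on_exp continuous_on_const continuous_on_id)
  also have "\<dots> \<le> C / K * exp (K * T)"
    using integral_unique[OF I] \<open>0 \<le> C\<close> \<open>0 < K\<close> by simp
  finally show ?thesis .
qed

text \<open>The Picard operator is a contraction for the weight \<open>exp (- 2 * L * t)\<close>, so that no
  continuation of local solutions is needed.\<close>

lemma lipschitz_ode_forward:
  fixes f :: "'a::banach \<Rightarrow> 'a"
  assumes f: "L-lipschitz_on UNIV f" and "0 < L"
  obtains x where "x 0 = x0" "\<And>t. 0 \<le> t \<Longrightarrow> (x has_vector_derivative f (x t)) (at t within {0..})"
proof -
  define K where "K = 2 * L"
  have "0 < K" using \<open>0 < L\<close> by (simp add: K_def)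
  have fL: "norm (f u - f w) \<le> L * norm (u - w)" for u w
    using lipschitz_on_normD[OF f] by simp
  have fc: "continuous_on S f" for S
    using lipschitz_on_continuous_on[OF f] continuous_on_subset by blast
  \<comment> \<open>The unknown is the weighted curve \<open>y t = exp (- K * t) * x t\<close>,
    which stays bounded even if \<open>x\<close> grows exponentially; \<open>h y\<close> is the
    field along the unweighted curve.\<close>
  define h where "h y s = f (exp (K * s) *\<^sub>R apply_bcontfun y s)" for y :: "real \<Rightarrow>\<^sub>C 'a" and s
  have hc: "continuous_on UNIV (h y)" for y
    unfolding h_def
    by (intro continuous_on_compose2[OF fc[of UNIV]] continuous_intros continuous_on_apply_bcontfun) auto
  \<comment> \<open>Elements of the space of bounded continuous functions live on the whole line;
    \<open>max 0 t\<close> freezes the curve at \<open>x0\<close> for negative times.\<close>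
  define I where "I y t = x0 + integral {0..max 0 t} (h y)" for y t
  have Ic: "continuous_on UNIV (I y)" for y
    unfolding I_def
    by (intro continuous_intros continuous_on_compose2[OF continuous_on_integral_atLeast[OF hc]]) auto
  define T where "T y t = exp (- K * max 0 t) *\<^sub>R I y t" for y t
  have weight: "exp (- K * max 0 t) * (C / K * exp (K * max 0 t)) = C / K" for C t :: real
    by (simp add: exp_minus field_simps)
  have T_bcontfun: "T y \<in> bcontfun" for y
  proof -
    obtain B where B: "0 < B" "\<And>s. norm (apply_bcontfun y s) \<le> B"
      using bounded_apply_bcontfun[of y] unfolding bounded_pos by auto
    define C where "C = norm (f 0) + L * B"
    have "0 \<le> C" using B \<open>0 < L\<close> by (simp add: C_def)
    have hb: "norm (h y s) \<le> C * exp (K * s)" if "0 \<le> s" for s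
    proof -
      have "norm (h y s) \<le> norm (f 0) + L * norm (exp (K * s) *\<^sub>R apply_bcontfun y s)"
        unfolding h_def using fL[of "exp (K * s) *\<^sub>R apply_bcontfun y s" 0]
        by (smt (verit) diff_zero norm_triangle_sub)
      also have "\<dots> \<le> norm (f 0) * exp (K * s) + L * (exp (K * s) * B)"
        using that \<open>0 < L\<close> \<open>0 < K\<close> B
        by (intro add_mono mult_left_mono) (auto intro!: mult_left_mono simp: mult_le_cancel_left1)
      finally show ?thesis by (simp add: C_def algebra_simps)
    qed
    have "norm (T y t) \<le> norm x0 + C / K" for t
    proof -
      have "norm (T y t) \<le> exp (- K * max 0 t) * (norm x0 + C / K * exp (K * max 0 t))"
        unfolding T_def I_def norm_scaleR abs_exp_cancel
        using norm_integral_exp_bound[OF hc \<open>0 < K\<close> _ \<open>0 \<le> C\<close> hb, of "max 0 t"]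
        by (intro mult_left_mono) (auto intro: norm_triangle_le)
      also have "\<dots> \<le> norm x0 + C / K"
        unfolding distrib_left weight using \<open>0 < K\<close> by (simp add: mult_left_le_one_le)
      finally show ?thesis .
    qed
    moreover have "continuous_on UNIV (T y)"
      unfolding T_def by (intro continuous_intros Ic)
    ultimately show ?thesis
      unfolding bcontfun_def bounded_iff by blast
  qed
  define P where "P y = Bcontfun (T y)" for y
  have P: "apply_bcontfun (P y) = T y" for y
    unfolding P_def by (simp add: Bcontfun_inverse T_bcontfun)
  have "dist (P y) (P w) \<le> 1/2 * dist y w" for y w
  proof (rule dist_bound)
    fix t :: real
    let ?t = "max 0 t"
    have hb: "norm (h y s - h w s) \<le> L * dist y w * exp (K * s)" for s
    proof -
      have "norm (h y s - h w s) \<le> L * norm (exp (K * s) *\<^sub>R (apply_bcontfun y s - apply_bcontfun w s))"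
        using fL unfolding h_def by (metis scaleR_right_diff_distrib)
      also have "\<dots> \<le> L * (exp (K * s) * dist y w)"
        using \<open>0 < L\<close> dist_bounded[of y s w] by (intro mult_left_mono) (auto simp: dist_norm)
      finally show ?thesis by (simp add: algebra_simps)
    qed
    have "I y t - I w t = integral {0..?t} (\<lambda>s. h y s - h w s)"
      unfolding I_def
      by (subst integral_diff) (auto intro!: integrable_continuous_real continuous_on_subset[OF hc])
    then have "norm (I y t - I w t) \<le> L * dist y w / K * exp (K * ?t)"
      using norm_integral_exp_bound[of "\<lambda>s. h y s - h w s" K ?t "L * dist y w"] hb hc \<open>0 < K\<close> \<open>0 < L\<close>
      by (auto intro!: continuous_on_diff)
    then have "norm (T y t - T w t) \<le> exp (- K * ?t) * (L * dist y w / K * exp (K * ?t))"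
      unfolding T_def scaleR_right_diff_distrib[symmetric] norm_scaleR abs_exp_cancel
      by (rule mult_left_mono) simp
    also have "\<dots> = 1/2 * dist y w"
      unfolding weight using \<open>0 < L\<close> by (simp add: K_def)
    finally show "dist (apply_bcontfun (P y) t) (apply_bcontfun (P w) t) \<le> 1/2 * dist y w"
      by (simp add: P dist_norm)
  qed
  then obtain y where "P y = y"
    using banach_fix_type[of "1/2" P] by auto
  then have y: "apply_bcontfun y t = T y t" for t
    by (metis P)
  have hI: "h y t = f (I y t)" if "0 \<le> t" for t
    unfolding h_def y T_def using that by (simp add: exp_minus)
  have "(I y has_vector_derivative f (I y t)) (at t within {0..})" if "0 \<le> t" for t
  proof -
    have "((\<lambda>t. x0 + integral {0..t} (h y)) has_vector_derivative h y t) (at t within {0..})"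
      using integral_has_vector_derivative_atLeast[OF hc that]
      by (subst add.commute) (auto intro!: derivative_eq_intros)
    then show ?thesis
      unfolding hI[OF that, symmetric]
      by (rule has_vector_derivative_transform_within[where d=1]) (use that in \<open>auto simp: I_def\<close>)
  qed
  then show ?thesis
    using that[of "I y"] by (simp add: I_def)
qed

text \<open>A forward solution for \<open>f\<close> and a time-reversed forward solution for
  \<open>- f\<close> are glued at 0, where both one-sided derivatives equal
  \<open>f x0\<close>.\<close>

lemma lipschitz_ode_global:
  fixes f :: "'a::banach \<Rightarrow> 'a"
  assumes f: "L-lipschitz_on UNIV f"
  obtains x where "x 0 = x0" "\<And>t. (x has_vector_derivative f (x t)) (at t)"
proof -
  define L' where "L' = max L 1"
  have "0 < L'" by (simp add: L'_def)
  have f': "L'-lipschitz_on UNIV f" "L'-lipschitz_on UNIV (\<lambda>x. - f x)"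
    using lipschitz_on_le[OF f, of L'] by (auto simp: L'_def lipschitz_on_minus)
  obtain p where p: "p 0 = x0" "\<And>t. 0 \<le> t \<Longrightarrow> (p has_vector_derivative f (p t)) (at t within {0..})"
    using lipschitz_ode_forward[OF f'(1) \<open>0 < L'\<close>] by blast
  obtain q where q: "q 0 = x0" "\<And>t. 0 \<le> t \<Longrightarrow> (q has_vector_derivative - f (q t)) (at t within {0..})"
    using lipschitz_ode_forward[OF f'(2) \<open>0 < L'\<close>] by blast
  have q': "((\<lambda>t. q (- t)) has_vector_derivative f (q (- t))) (at t within {..0})" if "t \<le> 0" for t
  proof -
    have "(q \<circ> uminus has_vector_derivative (-1) *\<^sub>R - f (q (- t))) (at t within {..0})"
    proof (rule vector_diff_chain_within)
      show "(uminus has_vector_derivative (-1 :: real)) (at t within {..0})"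
        by (rule derivative_eq_intros refl)+
      show "(q has_vector_derivative - f (q (- t))) (at (- t) within uminus ` {..0})"
        using q(2)[of "- t"] that by simp
    qed
    then show ?thesis by (simp add: o_def)
  qed
  define x where "x t = (if t \<in> {0..} then p t else q (- t))" for t
  have "(x has_vector_derivative f (x t)) (at t)" for t
  proof -
    have absorb: "{..0} \<union> {0..} \<inter> {..0} = {..(0::real)}" by blast
    have "(x has_vector_derivative (if t \<in> {0..} then f (p t) else f (q (- t)))) (at t within UNIV)"
      unfolding x_def
      by (rule has_vector_derivative_If_within_closures[where T="{..0}"])
        (use p q q' in \<open>auto simp: absorb\<close>)
    then show ?thesis by (simp add: x_def if_distrib)
  qed
  then show ?thesis
    using that[of x] p(1) by (simp add: x_def)
qed

text \<open>Gronwall's inequality for the squared distance \<open>p\<close>, which is differentiable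
  even where the solutions meet: from \<open>\<bar>p'\<bar> \<le> 2 * L * p\<close>, the function
  \<open>exp (- 2 * L * t) * p t\<close> is nonincreasing and \<open>exp (2 * L * t) * p t\<close>
  is nondecreasing, which settles positive and negative times respectively.\<close>

lemma lipschitz_ode_dist_le:
  fixes f :: "'a::real_inner \<Rightarrow> 'a"
  assumes f: "L-lipschitz_on UNIV f"
    and x: "\<And>t. (x has_vector_derivative f (x t)) (at t)"
    and y: "\<And>t. (y has_vector_derivative f (y t)) (at t)"
  shows "dist (x t) (y t) \<le> exp (L * \<bar>t\<bar>) * dist (x 0) (y 0)"
proof -
  define p where "p t = (norm (x t - y t))\<^sup>2" for t
  define p' where "p' t = 2 * ((x t - y t) \<bullet> (f (x t) - f (y t)))" for t
  have p: "(p has_real_derivative p' t) (at t)" for t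
  proof -
    have "((\<lambda>t. (x t - y t) \<bullet> (x t - y t)) has_derivative
        (\<lambda>h. (x t - y t) \<bullet> (h *\<^sub>R (f (x t) - f (y t))) + (h *\<^sub>R (f (x t) - f (y t))) \<bullet> (x t - y t))) (at t)"
      using x[of t] y[of t] unfolding has_vector_derivative_def
      by (auto intro!: derivative_eq_intros simp: algebra_simps)
    then show ?thesis
      unfolding has_field_derivative_def p_def p'_def power2_norm_eq_inner
      by (rule has_derivative_eq_rhs) (auto simp: inner_commute algebra_simps)
  qed
  have p': "\<bar>p' t\<bar> \<le> 2 * L * p t" for t
  proof -
    have "\<bar>(x t - y t) \<bullet> (f (x t) - f (y t))\<bar> \<le> norm (x t - y t) * (L * norm (x t - y t))"
      using lipschitz_on_normD[OF f, of "x t" "y t"]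
      by (intro order_trans[OF Cauchy_Schwarz_ineq2] mult_left_mono) auto
    then show ?thesis by (simp add: p'_def p_def abs_mult power2_eq_square algebra_simps)
  qed
  have "p t \<le> exp (2 * L * \<bar>t\<bar>) * p 0"
  proof (cases "0 \<le> t")
    case True
    have "exp (- 2 * L * t) * p t \<le> exp (- 2 * L * 0) * p 0"
    proof (rule DERIV_nonpos_imp_nonincreasing[where f="\<lambda>t. exp (- 2 * L * t) * p t", OF True])
      fix s
      have "((\<lambda>t. exp (- 2 * L * t) * p t) has_real_derivative exp (- 2 * L * s) * (p' s - 2 * L * p s)) (at s)"
        by (auto intro!: derivative_eq_intros p simp: algebra_simps)
      moreover have "exp (- 2 * L * s) * (p' s - 2 * L * p s) \<le> 0"
        using p'[of s] by (intro mult_nonneg_nonpos) auto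
      ultimately show "\<exists>y. ((\<lambda>t. exp (- 2 * L * t) * p t) has_real_derivative y) (at s) \<and> y \<le> 0"
        by blast
    qed
    then show ?thesis using True by (simp add: exp_minus field_simps)
  next
    case False
    have "exp (2 * L * t) * p t \<le> exp (2 * L * 0) * p 0"
    proof (rule DERIV_nonneg_imp_nondecreasing[where f="\<lambda>t. exp (2 * L * t) * p t"])
      fix s
      have "((\<lambda>t. exp (2 * L * t) * p t) has_real_derivative exp (2 * L * s) * (p' s + 2 * L * p s)) (at s)"
        by (auto intro!: derivative_eq_intros p simp: algebra_simps)
      moreover have "exp (2 * L * s) * (p' s + 2 * L * p s) \<ge> 0"
        using p'[of s] by (intro mult_nonneg_nonneg) auto
      ultimately show "\<exists>y. ((\<lambda>t. exp (2 * L * t) * p t) has_real_derivative y) (at s) \<and> y \<ge> 0"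
        by blast
    qed (use False in simp)
    then show ?thesis using False by (simp add: exp_minus field_simps)
  qed
  also have "\<dots> = (exp (L * \<bar>t\<bar>) * norm (x 0 - y 0))\<^sup>2"
    by (simp add: p_def power_mult_distrib exp_double[symmetric] mult.assoc)
  finally show ?thesis
    unfolding p_def dist_norm by (rule power2_le_imp_le) auto
qed

section \<open>Asymptotics of damped oscillators\<close>

lemma bdd_mono_converges_at_top:
  fixes f :: "real \<Rightarrow> real"
  assumes mono: "\<And>s t. 0 \<le> s \<Longrightarrow> s \<le> t \<Longrightarrow> f s \<le> f t" and bdd: "\<And>t. 0 \<le> t \<Longrightarrow> f t \<le> B"
  obtains l where "(f \<longlongrightarrow> l) at_top"
proof -
  have bdd': "bdd_above (f ` {0..})" using bdd by (auto intro!: bdd_aboveI2[where M=B])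
  have "(f \<longlongrightarrow> Sup (f ` {0..})) at_top"
  proof (rule increasing_tendsto)
    show "\<forall>\<^sub>F t in at_top. f t \<le> Sup (f ` {0..})"
      using eventually_ge_at_top[of 0]
      by eventually_elim (auto intro!: cSup_upper bdd')
    fix x assume "x < Sup (f ` {0..})"
    then obtain s where "0 \<le> s" "x < f s"
      using less_cSup_iff[OF _ bdd'] by auto
    show "\<forall>\<^sub>F t in at_top. x < f t"
      using eventually_ge_at_top[of s]
      by eventually_elim (use mono \<open>0 \<le> s\<close> \<open>x < f s\<close> in \<open>fastforce intro: less_le_trans\<close>)
  qed
  then show ?thesis by (rule that)
qed

text \<open>Once \<open>f\<close> has nearly settled, the mean value theorem finds in every window
  of fixed length \<open>r\<close> a point where \<open>h\<close> is small. The bound on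
  \<open>h'\<close> carries this smallness back to the start of the window.\<close>

lemma barbalat:
  fixes f h h' :: "real \<Rightarrow> real"
  assumes f: "\<And>t. 0 \<le> t \<Longrightarrow> (f has_real_derivative h t) (at t)"
    and h: "\<And>t. 0 \<le> t \<Longrightarrow> (h has_real_derivative h' t) (at t)"
    and bound: "\<And>t. 0 \<le> t \<Longrightarrow> \<bar>h' t\<bar> \<le> C"
    and lim: "(f \<longlongrightarrow> l) at_top"
  shows "(h \<longlongrightarrow> 0) at_top"
proof (rule tendstoI)
  fix e :: real assume "0 < e"
  have "0 \<le> C" using bound[of 0] by simp
  \<comment> \<open>Short enough that \<open>h\<close> varies by less than \<open>e / 2\<close> over
    the window; \<open>C + 1\<close> instead of \<open>C\<close> avoids a division by zero.\<close>
  define r where "r = e / (2 * (C + 1))"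
  have "0 < r" using \<open>0 < e\<close> \<open>0 \<le> C\<close> by (simp add: r_def)
  have Cr: "C * r < e / 2"
    using \<open>0 < e\<close> \<open>0 \<le> C\<close> by (simp add: r_def field_simps)
  have "\<forall>\<^sub>F t in at_top. dist (f t) l < e * r / 4"
    using lim \<open>0 < e\<close> \<open>0 < r\<close> by (intro tendstoD) auto
  then obtain T where T: "\<And>t. T \<le> t \<Longrightarrow> dist (f t) l < e * r / 4"
    unfolding eventually_at_top_linorder by auto
  show "\<forall>\<^sub>F t in at_top. dist (h t) 0 < e"
    using eventually_ge_at_top[of "max 0 T"]
  proof eventually_elim
    case (elim t)
    then have "0 \<le> t" "T \<le> t" by auto
    obtain \<tau> where \<tau>: "t < \<tau>" "\<tau> < t + r" "f (t + r) - f t = (t + r - t) * h \<tau>"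
      using MVT2[of t "t + r" f h] f \<open>0 < r\<close> \<open>0 \<le> t\<close> by auto
    have "\<bar>f (t + r) - f t\<bar> < r * (e / 2)"
      using T[of t] T[of "t + r"] \<open>T \<le> t\<close> \<open>0 < r\<close> mult.commute[of e r]
      unfolding dist_real_def by (simp add: abs_if split: if_splits)
    then have "r * \<bar>h \<tau>\<bar> < r * (e / 2)"
      using \<tau>(3) \<open>0 < r\<close> by (simp add: abs_mult)
    then have "\<bar>h \<tau>\<bar> < e / 2" using \<open>0 < r\<close> by simp
    moreover have "\<bar>h t - h \<tau>\<bar> \<le> C * \<bar>t - \<tau>\<bar>"
      using field_differentiable_bound[of "{0..}" h h' C t \<tau>] h bound \<open>0 \<le> t\<close> \<tau>(1)
      by (auto simp: has_field_derivative_at_within)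
    moreover have "C * \<bar>t - \<tau>\<bar> \<le> C * r"
      using \<tau> \<open>0 \<le> C\<close> by (intro mult_left_mono) auto
    ultimately show ?case using Cr by simp
  qed
qed

lemma compact_continuous_abs_bound:
  fixes f :: "'a::topological_space \<Rightarrow> real"
  assumes "compact C" "continuous_on C f"
  shows "\<exists>b. \<forall>x\<in>C. \<bar>f x\<bar> \<le> b"
  using compact_imp_bounded[OF compact_continuous_image[OF assms(2,1)]] unfolding bounded_iff by auto

text \<open>On the part of \<open>C\<close> outside a ball around \<open>p\<close>, the function
  \<open>\<bar>g\<bar>\<close> has a positive minimum by compactness, so small values of
  \<open>g\<close> force \<open>z\<close> into the ball.\<close>

lemma tendsto_unique_zero_compact:
  fixes g :: "'a::metric_space \<Rightarrow> real"
  assumes "compact C" "continuous_on C g" "\<And>x. x \<in> C \<Longrightarrow> g x = 0 \<Longrightarrow> x = p"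
    and z: "\<forall>\<^sub>F t in net. z t \<in> C" and lim: "((\<lambda>t. g (z t)) \<longlongrightarrow> 0) net"
  shows "(z \<longlongrightarrow> p) net"
proof (rule tendstoI)
  fix e :: real assume "0 < e"
  define D where "D = C - ball p e"
  have "compact D" unfolding D_def using \<open>compact C\<close> by (intro compact_diff) auto
  show "\<forall>\<^sub>F t in net. dist (z t) p < e"
  proof (cases "D = {}")
    case True
    show ?thesis using z by eventually_elim (use True in \<open>auto simp: D_def dist_commute\<close>)
  next
    case False
    have "continuous_on D (\<lambda>x. \<bar>g x\<bar>)"
      by (intro continuous_intros continuous_on_subset[OF assms(2)]) (auto simp: D_def)
    then obtain x where x: "x \<in> D" "\<And>y. y \<in> D \<Longrightarrow> \<bar>g x\<bar> \<le> \<bar>g y\<bar>"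
      using continuous_attains_inf[OF \<open>compact D\<close> False] by blast
    have "g x \<noteq> 0" using x(1) assms(3)[of x] \<open>0 < e\<close> by (auto simp: D_def)
    then have "\<forall>\<^sub>F t in net. dist (g (z t)) 0 < \<bar>g x\<bar>" using lim by (intro tendstoD) auto
    with z show ?thesis
      by eventually_elim (use x(2) in \<open>fastforce simp: D_def dist_commute not_less\<close>)
  qed
qed

text \<open>LaSalle's principle by applying Barbalat's lemma first to the energy and then to \<open>v\<close>.
  A negative \<open>d\<close> serves for the reversed time direction.\<close>

lemma damped_oscillator_limit:
  fixes z v g g' G :: "real \<Rightarrow> real"
  assumes G: "\<And>x. (G has_real_derivative g x) (at x)"
    and g: "\<And>x. (g has_real_derivative g' x) (at x)"
    and g': "continuous_on UNIV g'"
    and "d \<noteq> 0" and C: "compact C" and zero: "\<And>x. x \<in> C \<Longrightarrow> g x = 0 \<Longrightarrow> x = p"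
    and z: "\<And>t. 0 \<le> t \<Longrightarrow> (z has_real_derivative v t) (at t)"
    and v: "\<And>t. 0 \<le> t \<Longrightarrow> (v has_real_derivative - g (z t) - d * v t) (at t)"
    and zC: "\<And>t. 0 \<le> t \<Longrightarrow> z t \<in> C" and vB: "\<And>t. 0 \<le> t \<Longrightarrow> \<bar>v t\<bar> \<le> B"
  shows "(z \<longlongrightarrow> p) at_top" "(v \<longlongrightarrow> 0) at_top"
proof -
  have cont: "continuous_on C G" "continuous_on C g" "continuous_on C g'"
    using DERIV_continuous_on[of C G g] DERIV_continuous_on[of C g g'] G g continuous_on_subset[OF g']
    by (simp_all add: has_field_derivative_at_within)
  obtain BG Bg Bg' where bnd: "\<And>x. x \<in> C \<Longrightarrow> \<bar>G x\<bar> \<le> BG" "\<And>x. x \<in> C \<Longrightarrow> \<bar>g x\<bar> \<le> Bg"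
      "\<And>x. x \<in> C \<Longrightarrow> \<bar>g' x\<bar> \<le> Bg'"
    using cont[THEN compact_continuous_abs_bound[OF C]] by blast
  have "0 \<le> B" using vB[of 0] by simp
  define a where "a t = - g (z t) - d * v t" for t
  define A where "A = Bg + \<bar>d\<bar> * B"
  have aA: "\<bar>a t\<bar> \<le> A" if "0 \<le> t" for t
  proof -
    have "\<bar>a t\<bar> \<le> \<bar>g (z t)\<bar> + \<bar>d * v t\<bar>" unfolding a_def by linarith
    also have "\<dots> \<le> A"
      unfolding A_def abs_mult using bnd(2) zC vB that by (intro add_mono mult_left_mono) auto
    finally show ?thesis .
  qed
  have v_a: "(v has_real_derivative a t) (at t)" if "0 \<le> t" for t
    using v[OF that] by (simp add: a_def)
  \<comment> \<open>Dividing the energy by \<open>- d\<close> turns its derivative into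
    \<open>v\<^sup>2\<close> whatever the sign of \<open>d\<close>, so that one monotonicity
    argument covers both time directions.\<close>
  define W where "W t = - ((v t)\<^sup>2 / 2 + G (z t)) / d" for t
  have W: "(W has_real_derivative (v t)\<^sup>2) (at t)" if "0 \<le> t" for t
    unfolding W_def using \<open>d \<noteq> 0\<close>
    by (auto intro!: derivative_eq_intros v_a that DERIV_chain2[OF G z]
      simp: a_def field_simps power2_eq_square)
  have W_le: "W t \<le> (B\<^sup>2 / 2 + BG) / \<bar>d\<bar>" if "0 \<le> t" for t
  proof -
    have "W t \<le> \<bar>(v t)\<^sup>2 / 2 + G (z t)\<bar> / \<bar>d\<bar>"
      unfolding W_def by (metis abs_divide abs_ge_self abs_minus_cancel)
    also have "\<dots> \<le> (B\<^sup>2 / 2 + BG) / \<bar>d\<bar>"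
      using bnd(1)[OF zC[OF that]] power_mono[OF vB[OF that], of 2]
      by (intro divide_right_mono order_trans[OF abs_triangle_ineq] add_mono) auto
    finally show ?thesis .
  qed
  have "W s \<le> W t" if "0 \<le> s" "s \<le> t" for s t
    using that by (intro DERIV_nonneg_imp_nondecreasing[OF that(2), of W])
      (auto intro!: exI[of _ "(v _)\<^sup>2"] W)
  then obtain l where l: "(W \<longlongrightarrow> l) at_top"
    using bdd_mono_converges_at_top[of W] W_le by blast
  have "((\<lambda>t. (v t)\<^sup>2) \<longlongrightarrow> 0) at_top"
  proof (rule barbalat[OF W _ _ l])
    fix t :: real assume t: "0 \<le> t"
    show "((\<lambda>t. (v t)\<^sup>2) has_real_derivative 2 * (v t * a t)) (at t)"
      by (rule derivative_eq_intros v_a t refl)+ simp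
    show "\<bar>2 * (v t * a t)\<bar> \<le> 2 * (B * A)"
      unfolding abs_mult using vB[OF t] aA[OF t] \<open>0 \<le> B\<close> by (auto intro!: mult_mono)
  qed
  then have "((\<lambda>t. sqrt ((v t)\<^sup>2)) \<longlongrightarrow> sqrt 0) at_top" by (rule tendsto_real_sqrt)
  then show v0: "(v \<longlongrightarrow> 0) at_top" by (simp add: tendsto_rabs_zero_iff)
  have "(a \<longlongrightarrow> 0) at_top"
  proof (rule barbalat[OF v_a _ _ v0])
    fix t :: real assume t: "0 \<le> t"
    show "(a has_real_derivative - (g' (z t) * v t) - d * a t) (at t)"
      unfolding a_def[abs_def]
      by (rule derivative_eq_intros v[OF t] z[OF t] DERIV_chain2[OF g] refl)+ simp
    have "\<bar>- (g' (z t) * v t) - d * a t\<bar> \<le> \<bar>g' (z t)\<bar> * \<bar>v t\<bar> + \<bar>d\<bar> * \<bar>a t\<bar>"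
      unfolding abs_mult[symmetric] by linarith
    also have "\<dots> \<le> Bg' * B + \<bar>d\<bar> * A"
      using bnd(3)[OF zC[OF t]] vB[OF t] aA[OF t] \<open>0 \<le> B\<close> by (intro add_mono mult_mono) auto
    finally show "\<bar>- (g' (z t) * v t) - d * a t\<bar> \<le> Bg' * B + \<bar>d\<bar> * A" .
  qed
  \<comment> \<open>Acceleration and speed both vanish in the limit, and the equation then leaves
    nothing for the force.\<close>
  then have "((\<lambda>t. - a t - d * v t) \<longlongrightarrow> - 0 - d * 0) at_top"
    by (intro tendsto_intros v0)
  then have "((\<lambda>t. g (z t)) \<longlongrightarrow> 0) at_top" by (simp add: a_def)
  moreover have "\<forall>\<^sub>F t in at_top. z t \<in> C"
    using eventually_ge_at_top[of 0] by eventually_elim (rule zC)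
  ultimately show "(z \<longlongrightarrow> p) at_top"
    by (intro tendsto_unique_zero_compact[OF C cont(2) zero])
qed

section \<open>Orbits from the saddle to the bottom of the well\<close>

text \<open>With \<open>\<phi>\<close> the minimum of two quantities that are positive inside a
  region, this locates the last time outside that region; the mirrored version below locates the
  first exit.\<close>

lemma obtain_last_nonpos:
  fixes \<phi> :: "real \<Rightarrow> real"
  assumes "continuous_on {s..t} \<phi>" "s \<le> t" "\<phi> s \<le> 0"
  obtains r where "s \<le> r" "r \<le> t" "\<phi> r \<le> 0" "\<forall>u\<in>{r<..t}. 0 < \<phi> u"
proof -
  let ?S = "{u \<in> {s..t}. \<phi> u \<le> 0}"
  have "closed ?S"
    using assms(1) by (intro continuous_on_closed_Collect_le continuous_intros) auto
  then have "compact ?S"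
    using compact_Int_closed[of "{s..t}" ?S] by (simp add: Int_def conj_commute conj_left_commute)
  moreover have "?S \<noteq> {}" using assms by auto
  ultimately obtain r where r: "r \<in> ?S" "\<And>u. u \<in> ?S \<Longrightarrow> u \<le> r"
    using compact_attains_sup[of ?S] by blast
  show ?thesis
  proof (rule that[of r])
    have "0 < \<phi> u" if "u \<in> {r<..t}" for u
      using r(1) r(2)[of u] that by force
    then show "\<forall>u\<in>{r<..t}. 0 < \<phi> u" by blast
  qed (use r(1) in auto)
qed

lemma obtain_first_nonpos:
  fixes \<phi> :: "real \<Rightarrow> real"
  assumes "continuous_on {s..t} \<phi>" "s \<le> t" "\<phi> t \<le> 0"
  obtains r where "s \<le> r" "r \<le> t" "\<phi> r \<le> 0" "\<forall>u\<in>{s..<r}. 0 < \<phi> u"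
proof -
  have "continuous_on {-t..-s} (\<lambda>u. \<phi> (- u))"
    by (rule continuous_on_compose2[OF assms(1)]) (auto intro!: continuous_intros)
  then obtain r where r: "- t \<le> r" "r \<le> - s" "\<phi> (- r) \<le> 0" "\<forall>u\<in>{r<..-s}. 0 < \<phi> (- u)"
    by (rule obtain_last_nonpos) (use assms(2,3) in auto)
  have "0 < \<phi> u" if "u \<in> {s..<- r}" for u
    using bspec[OF r(4), of "- u"] that by auto
  then show ?thesis
    using r(1-3) by (intro that[of "- r"]) auto
qed

section \<open>Damped motion in a potential well: the clamped system and its flow\<close>

locale damped_oscillator =
  fixes g g' G :: "real \<Rightarrow> real" and d a b m :: real
  assumes G: "\<And>x. (G has_real_derivative g x) (at x)"
    and g: "\<And>x. (g has_real_derivative g' x) (at x)"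
    and g': "continuous_on UNIV g'"
    and d: "0 < d" and ab: "a < b" and bm: "b < m"
    and ga: "g a = 0" and gb: "g b = 0"
    and g_neg: "\<And>x. a < x \<Longrightarrow> x < b \<Longrightarrow> g x < 0"
    and g_pos: "\<And>x. b < x \<Longrightarrow> x \<le> m \<Longrightarrow> 0 < g x"
    and G_eq: "G a = G m" and g'a: "g' a < 0"
begin

definition clamp :: "real \<Rightarrow> real" where
  "clamp x = max a (min m x)"

definition field :: "real \<times> real \<Rightarrow> real \<times> real" where
  "field p = (snd p, - g (clamp (fst p)) - d * snd p)"

definition clamped_solution :: "(real \<Rightarrow> real) \<Rightarrow> (real \<Rightarrow> real) \<Rightarrow> bool" where
  "clamped_solution z v \<longleftrightarrow> (\<forall>t. (z has_real_derivative v t) (at t) \<and>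
     (v has_real_derivative - g (clamp (z t)) - d * v t) (at t))"

lemma clamp_mem: "clamp x \<in> {a..m}"
  and clamp_id: "a \<le> x \<Longrightarrow> x \<le> m \<Longrightarrow> clamp x = x"
  using ab bm by (auto simp: clamp_def)

lemma g_cont: "continuous_on S g"
  using DERIV_continuous_on[of S g g'] g by (simp add: has_field_derivative_at_within)

lemma G_cont: "continuous_on S G"
  using DERIV_continuous_on[of S G g] G by (simp add: has_field_derivative_at_within)

lemma clamped_solution_iff:
  "clamped_solution z v \<longleftrightarrow>
     (\<forall>t. ((\<lambda>t. (z t, v t)) has_vector_derivative field (z t, v t)) (at t))"
proof -
  have "((\<lambda>t. (z t, v t)) has_vector_derivative (p, q)) (at t) \<longleftrightarrow>
      (z has_vector_derivative p) (at t) \<and> (v has_vector_derivative q) (at t)" for t p q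
  proof
    assume *: "((\<lambda>t. (z t, v t)) has_vector_derivative (p, q)) (at t)"
    show "(z has_vector_derivative p) (at t) \<and> (v has_vector_derivative q) (at t)"
      using has_derivative_fst[OF *[unfolded has_vector_derivative_def]]
        has_derivative_snd[OF *[unfolded has_vector_derivative_def]]
      by (simp add: has_vector_derivative_def)
  qed (auto intro: has_vector_derivative_Pair)
  then show ?thesis
    by (simp add: clamped_solution_def field_def has_real_derivative_iff_has_vector_derivative)
qed

text \<open>Clamping is 1-Lipschitz and confines the argument of \<open>g\<close> to the compact
  interval \<open>{a..m}\<close>, where \<open>g'\<close> is bounded.\<close>

lemma field_lipschitz: "\<exists>L. L-lipschitz_on UNIV field"
proof -
  obtain B where B: "\<And>x. x \<in> {a..m} \<Longrightarrow> \<bar>g' x\<bar> \<le> B"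
    using compact_continuous_abs_bound[OF compact_Icc continuous_on_subset[OF g' subset_UNIV]] by blast
  have "0 \<le> B" using B[of a] ab bm by auto
  have gB: "\<bar>g (clamp x) - g (clamp y)\<bar> \<le> B * \<bar>x - y\<bar>" for x y
  proof -
    have "norm (g (clamp x) - g (clamp y)) \<le> B * norm (clamp x - clamp y)"
      using clamp_mem g B
      by (intro field_differentiable_bound[of "{a..m}" g g']) (auto simp: has_field_derivative_at_within)
    also have "\<dots> \<le> B * norm (x - y)"
      using \<open>0 \<le> B\<close> by (intro mult_left_mono) (auto simp: clamp_def)
    finally show ?thesis by simp
  qed
  have "(1 + (B + d))-lipschitz_on UNIV field"
  proof (rule lipschitz_onI)
    fix p q :: "real \<times> real"
    have "dist (field p) (field q) \<le> \<bar>snd p - snd q\<bar>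
        + \<bar>(- g (clamp (fst p)) - d * snd p) - (- g (clamp (fst q)) - d * snd q)\<bar>"
      using norm_Pair_le[of "snd p - snd q" "(- g (clamp (fst p)) - d * snd p) - (- g (clamp (fst q)) - d * snd q)"]
      by (simp add: dist_norm field_def)
    also have "\<dots> \<le> \<bar>snd p - snd q\<bar> + (\<bar>g (clamp (fst p)) - g (clamp (fst q))\<bar> + \<bar>d * (snd p - snd q)\<bar>)"
      by (simp add: algebra_simps)
    also have "\<dots> \<le> \<bar>snd p - snd q\<bar> + (B * \<bar>fst p - fst q\<bar> + d * \<bar>snd p - snd q\<bar>)"
      using gB[of "fst p" "fst q"] d by (simp add: abs_mult)
    also have "\<dots> \<le> dist p q + (B * dist p q + d * dist p q)"
      using dist_fst_le[of p q] dist_snd_le[of p q] d \<open>0 \<le> B\<close>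
      by (intro add_mono mult_left_mono) (auto simp: dist_real_def)
    finally show "dist (field p) (field q) \<le> (1 + (B + d)) * dist p q"
      by (simp add: algebra_simps)
  qed (use d \<open>0 \<le> B\<close> in auto)
  then show ?thesis by blast
qed

lemma clamped_solution_exists:
  "\<exists>z v. clamped_solution z v \<and> z 0 = z0 \<and> v 0 = v0"
proof -
  obtain L where "L-lipschitz_on UNIV field" using field_lipschitz by blast
  then obtain x where x: "x 0 = (z0, v0)" "\<And>t. (x has_vector_derivative field (x t)) (at t)"
    using lipschitz_ode_global by blast
  then have "clamped_solution (\<lambda>t. fst (x t)) (\<lambda>t. snd (x t))"
    by (simp add: clamped_solution_iff)
  with x(1) show ?thesis by fastforce
qed

text \<open>The constant is chosen before the solutions. This uniformity yields uniqueness as well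
  as continuous dependence on the initial speed in the shooting argument.\<close>

lemma clamped_solution_dist_le:
  "\<exists>L\<ge>0. \<forall>z v z' v' t. clamped_solution z v \<longrightarrow> clamped_solution z' v' \<longrightarrow>
     dist (z t, v t) (z' t, v' t) \<le> exp (L * \<bar>t\<bar>) * dist (z 0, v 0) (z' 0, v' 0)"
proof -
  obtain L where L: "L-lipschitz_on UNIV field" using field_lipschitz by blast
  show ?thesis
    using lipschitz_ode_dist_le[OF L] lipschitz_on_nonneg[OF L]
    unfolding clamped_solution_iff by blast
qed

lemma clamped_solution_shift:
  assumes "clamped_solution z v"
  shows "clamped_solution (\<lambda>t. z (t + c)) (\<lambda>t. v (t + c))"
  using assms unfolding clamped_solution_def by (auto intro: DERIV_shift[THEN iffD1])

text \<open>The system is autonomous, so orbits that share a state at different times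
  \<open>c\<close> and \<open>c'\<close> can be shifted to share it at time 0.\<close>

lemma clamped_solution_unique:
  assumes "clamped_solution z v" "clamped_solution z' v'" "z c = z' c'" "v c = v' c'"
  shows "z (t + c) = z' (t + c')" "v (t + c) = v' (t + c')"
proof -
  obtain L where "\<forall>z v z' v' t. clamped_solution z v \<longrightarrow> clamped_solution z' v' \<longrightarrow>
     dist (z t, v t) (z' t, v' t) \<le> exp (L * \<bar>t\<bar>) * dist (z 0, v 0) (z' 0, v' 0)"
    using clamped_solution_dist_le by blast
  from this[rule_format, OF clamped_solution_shift[OF assms(1), of c] clamped_solution_shift[OF assms(2), of c'], of t]
  have "(z (t + c), v (t + c)) = (z' (t + c'), v' (t + c'))"
    using assms(3,4) by simp
  then show "z (t + c) = z' (t + c')" "v (t + c) = v' (t + c')" by auto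
qed

text \<open>Together with uniqueness, this rest state prevents an orbit through any other state from
  reaching the saddle in finite time.\<close>

lemma saddle_solution: "clamped_solution (\<lambda>_. a) (\<lambda>_. 0)"
  using ga ab bm by (simp add: clamped_solution_def clamp_id)

lemma clamped_solutionD:
  assumes "clamped_solution z v"
  shows "(z has_real_derivative v t) (at t)"
    and "(v has_real_derivative - g (clamp (z t)) - d * v t) (at t)"
    and "continuous_on S z" "continuous_on S v"
  using assms DERIV_continuous_on[of S z v] DERIV_continuous_on[of S v "\<lambda>t. - g (clamp (z t)) - d * v t"]
  by (auto simp: clamped_solution_def has_field_derivative_at_within)

lemma energy_deriv:
  assumes "clamped_solution z v" "a \<le> z t" "z t \<le> m"
  shows "((\<lambda>t. (v t)\<^sup>2 / 2 + G (z t)) has_real_derivative - d * (v t)\<^sup>2) (at t)"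
proof -
  have v': "(v has_real_derivative - g (z t) - d * v t) (at t)"
    using clamped_solutionD(2)[OF assms(1), of t] assms(2,3) by (simp add: clamp_id)
  show ?thesis
    by (auto intro!: derivative_eq_intros v' DERIV_chain2[OF G clamped_solutionD(1)[OF assms(1)]]
      simp: field_simps power2_eq_square)
qed

text \<open>Started on the line \<open>z = c\<close> with speed \<open>w\<close>, the backward orbit leaves the quadrant
  \<open>a < z, 0 < v\<close> through \<open>v = 0\<close> for small \<open>w\<close> and through \<open>z = a\<close> for large \<open>w\<close>. Both sets of
  speeds are open, so by connectedness some orbit never leaves: it lies on the unstable manifold.\<close>

lemma backward_orbit_exists:
  assumes c: "a < c" "c < b"
  obtains z v where "clamped_solution z v" "z 0 = c" "\<And>t. t \<le> 0 \<Longrightarrow> a < z t" "\<And>t. t \<le> 0 \<Longrightarrow> 0 < v t"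
proof -
  obtain Z V where sol: "\<And>w. clamped_solution (Z w) (V w)" and init: "\<And>w. Z w 0 = c" "\<And>w. V w 0 = w"
    using clamped_solution_exists[of c] by metis
  note Z' = clamped_solutionD(1)[OF sol] and V' = clamped_solutionD(2)[OF sol]
  note Zc = clamped_solutionD(3)[OF sol] and Vc = clamped_solutionD(4)[OF sol]
  \<comment> \<open>The strict inequalities at time \<open>t\<close> and on the compact interval
    \<open>{t..0}\<close> make both sets open. The conditions on all of \<open>{t..0}\<close> make
    them disjoint: whichever of the two exits comes first rules out the other.\<close>
  define A where "A = {w. \<exists>t\<le>0. V w t < 0 \<and> (\<forall>s\<in>{t..0}. a < Z w s)}"
  define B where "B = {w. \<exists>t\<le>0. Z w t < a \<and> (\<forall>s\<in>{t..0}. 0 < V w s)}"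
  \<comment> \<open>Dependence on the initial speed is uniform over a compact time interval, so
    strict inequalities there persist for nearby speeds.\<close>
  have dep: "\<exists>\<delta>>0. \<forall>w'. \<bar>w' - w\<bar> < \<delta> \<longrightarrow> (\<forall>s\<in>{t..0}. \<bar>Z w' s - Z w s\<bar> < e \<and> \<bar>V w' s - V w s\<bar> < e)"
    if "0 < e" for w t e
  proof -
    obtain L where "0 \<le> L" and L0: "\<forall>z v z' v' t. clamped_solution z v \<longrightarrow> clamped_solution z' v' \<longrightarrow>
        dist (z t, v t) (z' t, v' t) \<le> exp (L * \<bar>t\<bar>) * dist (z 0, v 0) (z' 0, v' 0)"
      using clamped_solution_dist_le by blast
    have L: "dist (Z w' s, V w' s) (Z w s, V w s) \<le> exp (L * \<bar>s\<bar>) * \<bar>w' - w\<bar>" for w' w s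
      using L0[rule_format, OF sol[of w'] sol[of w], of s]
      by (simp add: init dist_Pair_Pair dist_real_def)
    show ?thesis
    proof (intro exI[of _ "e / exp (L * \<bar>t\<bar>)"] conjI allI impI ballI)
      fix w' s assume w': "\<bar>w' - w\<bar> < e / exp (L * \<bar>t\<bar>)" and s: "s \<in> {t..0}"
      have "exp (L * \<bar>s\<bar>) * \<bar>w' - w\<bar> \<le> exp (L * \<bar>t\<bar>) * \<bar>w' - w\<bar>"
        using s \<open>0 \<le> L\<close> by (intro mult_right_mono) (auto intro!: mult_left_mono)
      also have "\<dots> < e" using w' by (simp add: field_simps)
      finally have "dist (Z w' s, V w' s) (Z w s, V w s) < e"
        using L[of w' s w] by simp
      then show "\<bar>Z w' s - Z w s\<bar> < e" "\<bar>V w' s - V w s\<bar> < e"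
        using dist_fst_le[of "(Z w' s, V w' s)" "(Z w s, V w s)"] dist_snd_le[of "(Z w' s, V w' s)" "(Z w s, V w s)"]
        by (auto simp: dist_real_def)
    qed (use that in auto)
  qed
  have "open A"
    unfolding open_dist
  proof
    fix w assume "w \<in> A"
    then obtain t where t: "t \<le> 0" "V w t < 0" "\<And>s. s \<in> {t..0} \<Longrightarrow> a < Z w s" unfolding A_def by auto
    obtain r where r: "r \<in> {t..0}" "\<And>s. s \<in> {t..0} \<Longrightarrow> Z w r \<le> Z w s"
      using continuous_attains_inf[of "{t..0}" "Z w"] t(1) Zc by auto
    obtain \<delta> where "0 < \<delta>" and \<delta>: "\<And>w' s. \<bar>w' - w\<bar> < \<delta> \<Longrightarrow> s \<in> {t..0} \<Longrightarrow>
        \<bar>Z w' s - Z w s\<bar> < min (- V w t) (Z w r - a) \<and> \<bar>V w' s - V w s\<bar> < min (- V w t) (Z w r - a)"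
      using dep[of "min (- V w t) (Z w r - a)" w t] t(2) t(3)[OF r(1)] by auto
    have "w' \<in> A" if "dist w' w < \<delta>" for w'
    proof -
      have "V w' t < 0" using \<delta>[of w' t] that t(1) by (auto simp: dist_real_def)
      moreover have "a < Z w' s" if "s \<in> {t..0}" for s
        using \<delta>[of w' s] \<open>dist w' w < \<delta>\<close> r(2)[OF that] that by (auto simp: dist_real_def)
      ultimately show ?thesis using t(1) unfolding A_def by blast
    qed
    with \<open>0 < \<delta>\<close> show "\<exists>e>0. \<forall>y. dist y w < e \<longrightarrow> y \<in> A" by blast
  qed
  moreover have "open B"
    unfolding open_dist
  proof
    fix w assume "w \<in> B"
    then obtain t where t: "t \<le> 0" "Z w t < a" "\<And>s. s \<in> {t..0} \<Longrightarrow> 0 < V w s" unfolding B_def by auto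
    obtain r where r: "r \<in> {t..0}" "\<And>s. s \<in> {t..0} \<Longrightarrow> V w r \<le> V w s"
      using continuous_attains_inf[of "{t..0}" "V w"] t(1) Vc by auto
    obtain \<delta> where "0 < \<delta>" and \<delta>: "\<And>w' s. \<bar>w' - w\<bar> < \<delta> \<Longrightarrow> s \<in> {t..0} \<Longrightarrow>
        \<bar>Z w' s - Z w s\<bar> < min (a - Z w t) (V w r) \<and> \<bar>V w' s - V w s\<bar> < min (a - Z w t) (V w r)"
      using dep[of "min (a - Z w t) (V w r)" w t] t(2) t(3)[OF r(1)] by auto
    have "w' \<in> B" if "dist w' w < \<delta>" for w'
    proof -
      have "Z w' t < a" using \<delta>[of w' t] that t(1) by (auto simp: dist_real_def)
      moreover have "0 < V w' s" if "s \<in> {t..0}" for s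
        using \<delta>[of w' s] \<open>dist w' w < \<delta>\<close> r(2)[OF that] that by (auto simp: dist_real_def)
      ultimately show ?thesis using t(1) unfolding B_def by blast
    qed
    with \<open>0 < \<delta>\<close> show "\<exists>e>0. \<forall>y. dist y w < e \<longrightarrow> y \<in> B" by blast
  qed
  moreover have "A \<inter> B = {}"
  proof -
    have False if w: "w \<in> A" "w \<in> B" for w
    proof -
      obtain t where t: "t \<le> 0" "V w t < 0" "\<And>s. s \<in> {t..0} \<Longrightarrow> a < Z w s" using w(1) unfolding A_def by auto
      obtain u where u: "u \<le> 0" "Z w u < a" "\<And>s. s \<in> {u..0} \<Longrightarrow> 0 < V w s" using w(2) unfolding B_def by auto
      show False using t(1,2) t(3)[of u] u(1,2) u(3)[of t] by (cases "t \<le> u") auto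
    qed
    then show ?thesis by blast
  qed
  moreover have "A \<noteq> {}"
  proof -
    have "-1 \<in> A" unfolding A_def using init c by (auto intro!: exI[of _ 0])
    then show ?thesis by blast
  qed
  moreover have "B \<noteq> {}"
  proof -
    obtain \<mu> where \<mu>: "\<And>x. x \<in> {a..m} \<Longrightarrow> \<bar>g x\<bar> \<le> \<mu>"
      using compact_continuous_abs_bound[OF compact_Icc g_cont] by blast
    have "0 \<le> \<mu>" using \<mu>[of a] ab bm by auto
    \<comment> \<open>At speed \<open>\<mu> / d\<close> damping balances the largest possible force.
      An excess of 1 over this speed can only grow backwards in time.\<close>
    define w where "w = \<mu> / d + 1"
    have V1: "1 \<le> V w t" if "t \<le> 0" for t
    proof -
      have "exp (d * 0) * (V w 0 - \<mu> / d) \<le> exp (d * t) * (V w t - \<mu> / d)"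
      proof (rule DERIV_nonpos_imp_nonincreasing[where f="\<lambda>t. exp (d * t) * (V w t - \<mu> / d)", OF that])
        fix s
        have "((\<lambda>t. exp (d * t) * (V w t - \<mu> / d)) has_real_derivative
            exp (d * s) * (- g (clamp (Z w s)) - \<mu>)) (at s)"
          using d by (auto intro!: derivative_eq_intros V' simp: algebra_simps)
        moreover have "exp (d * s) * (- g (clamp (Z w s)) - \<mu>) \<le> 0"
          using \<mu>[OF clamp_mem, of "Z w s"] by (intro mult_nonneg_nonpos) auto
        ultimately show "\<exists>y. ((\<lambda>t. exp (d * t) * (V w t - \<mu> / d)) has_real_derivative y) (at s) \<and> y \<le> 0"
          by blast
      qed
      then have 1: "1 \<le> exp (d * t) * (V w t - \<mu> / d)"
        by (simp add: init w_def)
      have "0 < exp (d * t) * (V w t - \<mu> / d)" using 1 by linarith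
      then have "0 \<le> V w t - \<mu> / d" by (simp add: zero_less_mult_iff)
      then have "exp (d * t) * (V w t - \<mu> / d) \<le> 1 * (V w t - \<mu> / d)"
        using that d by (intro mult_right_mono) (auto simp: mult_nonneg_nonpos)
      with 1 have "1 + \<mu> / d \<le> V w t" by simp
      moreover have "0 \<le> \<mu> / d" using \<open>0 \<le> \<mu>\<close> d by simp
      ultimately show ?thesis by linarith
    qed
    \<comment> \<open>At speed at least 1, a time \<open>c - a + 1\<close> suffices to go back from
      \<open>c\<close> beyond \<open>a\<close>.\<close>
    define t where "t = a - c - 1"
    have "t < 0" using c by (simp add: t_def)
    obtain \<tau> where "t < \<tau>" "\<tau> < 0" "Z w 0 - Z w t = (0 - t) * V w \<tau>"
      using MVT2[OF \<open>t < 0\<close>, of "Z w" "V w"] Z' by blast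
    moreover have "(0 - t) * 1 \<le> (0 - t) * V w \<tau>"
      using V1[of \<tau>] \<open>t < 0\<close> \<open>\<tau> < 0\<close> by (intro mult_left_mono) auto
    ultimately have "- t \<le> Z w 0 - Z w t" by simp
    then have "Z w t < a" by (simp add: init t_def)
    then have "w \<in> B"
      unfolding B_def using V1 \<open>t < 0\<close> by (force intro!: exI[of _ t])
    then show ?thesis by blast
  qed
  ultimately have "\<not> UNIV \<subseteq> A \<union> B"
    using connectedD[OF connected_UNIV, of A B] by auto
  then obtain w where w: "w \<notin> A" "w \<notin> B" by auto
  have good: "a < Z w t \<and> 0 < V w t" if "t \<le> 0" for t
  proof (rule ccontr)
    assume "\<not> ?thesis"
    then have le: "min (Z w t - a) (V w t) \<le> 0" by auto
    have cont: "continuous_on {t..0} (\<lambda>t. min (Z w t - a) (V w t))"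
      by (intro continuous_intros Zc Vc)
    obtain r where "t \<le> r" and r: "r \<le> 0" "min (Z w r - a) (V w r) \<le> 0"
        "\<forall>u\<in>{r<..0}. 0 < min (Z w u - a) (V w u)"
      by (rule obtain_last_nonpos[OF cont \<open>t \<le> 0\<close> le])
    have "0 \<le> w"
    proof (rule ccontr)
      assume "\<not> 0 \<le> w"
      then have "w \<in> A" unfolding A_def using init c by (auto intro!: exI[of _ 0])
      with w show False by blast
    qed
    have ge: "a \<le> Z w r \<and> 0 \<le> V w r"
    proof (cases "r = 0")
      case True
      then show ?thesis using init c \<open>0 \<le> w\<close> by simp
    next
      case False
      have ev: "\<forall>\<^sub>F u in at_right r. a \<le> Z w u" "\<forall>\<^sub>F u in at_right r. 0 \<le> V w u"
        using r(1,3) False by (auto intro!: eventually_at_rightI[of r 0] less_imp_le)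
      have lim: "(Z w \<longlongrightarrow> Z w r) (at_right r)" "(V w \<longlongrightarrow> V w r) (at_right r)"
        using Zc[of UNIV w] Vc[of UNIV w]
        by (auto simp: continuous_on_eq_continuous_at isCont_def intro: tendsto_mono[OF at_le])
      show ?thesis
        using tendsto_lowerbound[OF lim(1), of a] tendsto_lowerbound[OF lim(2), of 0] ev by auto
    qed
    have near: "\<exists>e>0. \<forall>u. \<bar>u - r\<bar> < e \<longrightarrow> 0 < f u" if "continuous_on UNIV f" "0 < f r" for f :: "real \<Rightarrow> real"
    proof -
      have "open {u. 0 < f u}"
        using that(1) by (intro open_Collect_less continuous_intros) auto
      then show ?thesis
        using that(2) unfolding open_dist dist_real_def by blast
    qed
    \<comment> \<open>If the speed vanishes at \<open>r\<close>, the orbit is not at the saddle, so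
      the force there points to the right and the speed was negative just before: \<open>w\<close>
      lies in \<open>A\<close>. Otherwise the orbit crosses \<open>a\<close> with positive speed and
      was to the left of \<open>a\<close> just before: \<open>w\<close> lies in
      \<open>B\<close>.\<close>
    show False
    proof (cases "V w r = 0")
      case True
      have "Z w r \<noteq> a"
      proof
        assume "Z w r = a"
        then have "Z w (- r + r) = a"
          using clamped_solution_unique(1)[OF sol[of w] saddle_solution, where c=r and t="- r"] True by simp
        then show False using init c by simp
      qed
      then have "a < Z w r" using ge by simp
      have "Z w r \<le> Z w 0"
        by (rule DERIV_nonneg_imp_nondecreasing[OF r(1), of "Z w"])
          (use Z' r(3) True in \<open>fastforce simp: le_less\<close>)
      then have "g (Z w r) < 0"
        using \<open>a < Z w r\<close> c init by (intro g_neg) auto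
      then have "(V w has_real_derivative - g (Z w r)) (at r)" "0 < - g (Z w r)"
        using V'[of w r] True \<open>a < Z w r\<close> \<open>Z w r \<le> Z w 0\<close> c init bm by (auto simp: clamp_id)
      then obtain e where "0 < e" and e: "\<And>h. 0 < h \<Longrightarrow> h < e \<Longrightarrow> V w (r - h) < V w r"
        using DERIV_pos_inc_left[of "V w" "- g (Z w r)" r] by blast
      obtain e' where "0 < e'" and e': "\<And>u. \<bar>u - r\<bar> < e' \<Longrightarrow> 0 < Z w u - a"
        using near[of "\<lambda>u. Z w u - a"] \<open>a < Z w r\<close> Zc by (force intro!: continuous_intros)
      define h where "h = min e e' / 2"
      have h: "0 < h" "h < e" "h < e'" using \<open>0 < e\<close> \<open>0 < e'\<close> by (auto simp: h_def)
      have "a < Z w s" if "s \<in> {r - h..0}" for s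
        using e'[of s] bspec[OF r(3), of s] h that by (cases "s \<le> r") auto
      then have "w \<in> A"
        unfolding A_def using e[OF h(1,2)] True r(1) h(1) by (auto intro!: exI[of _ "r - h"])
      with w show False by blast
    next
      case False
      with ge have V_pos: "0 < V w r" by simp
      with ge r(2) have Z_eq: "Z w r = a" by auto
      obtain e where "0 < e" and e: "\<And>h. 0 < h \<Longrightarrow> h < e \<Longrightarrow> Z w (r - h) < Z w r"
        using DERIV_pos_inc_left[OF Z' V_pos] by blast
      obtain e' where "0 < e'" and e': "\<And>u. \<bar>u - r\<bar> < e' \<Longrightarrow> 0 < V w u"
        using near[of "V w"] V_pos Vc by blast
      define h where "h = min e e' / 2"
      have h: "0 < h" "h < e" "h < e'" using \<open>0 < e\<close> \<open>0 < e'\<close> by (auto simp: h_def)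
      have "0 < V w s" if "s \<in> {r - h..0}" for s
        using e'[of s] bspec[OF r(3), of s] h that by (cases "s \<le> r") auto
      then have "w \<in> B"
        unfolding B_def using e[OF h(1,2)] Z_eq r(1) h(1) by (auto intro!: exI[of _ "r - h"])
      with w show False by blast
    qed
  qed
  show ?thesis
    using that[OF sol[of w] init(1)] good by blast
qed

section \<open>Heteroclinic orbits: limits in both time directions and existence\<close>

definition heteroclinic :: "(real \<Rightarrow> real) \<Rightarrow> (real \<Rightarrow> real) \<Rightarrow> bool" where
  "heteroclinic z v \<longleftrightarrow>
     (\<forall>t. (z has_real_derivative v t) (at t) \<and> (v has_real_derivative - g (z t) - d * v t) (at t)) \<and>
     (\<forall>t. a < z t \<and> z t < m) \<and> bounded (range v) \<and>
     (z \<longlongrightarrow> a) at_bot \<and> (v \<longlongrightarrow> 0) at_bot \<and> (z \<longlongrightarrow> b) at_top \<and> (v \<longlongrightarrow> 0) at_top"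

text \<open>Confinement to the interval between \<open>a\<close> and \<open>m\<close> makes the
  clamp invisible, so that uniqueness for the Lipschitz field becomes available.\<close>

lemma heteroclinic_clamped_solution:
  assumes "heteroclinic z v"
  shows "clamped_solution z v"
  using assms by (auto simp: heteroclinic_def clamped_solution_def clamp_id less_imp_le)

text \<open>For backward times the orbit stays in \<open>{a..z 0}\<close>, where \<open>a\<close> is
  the only zero of \<open>g\<close> because \<open>z 0 < b\<close>. Reversing time turns the damping
  into \<open>- d\<close>, and the limit lemma, which allows either sign, applies.\<close>

lemma backward_limit:
  assumes sol: "clamped_solution z v"
    and z: "\<And>t. t \<le> 0 \<Longrightarrow> a < z t" and v: "\<And>t. t \<le> 0 \<Longrightarrow> 0 < v t" and "z 0 < b"
  shows "(z \<longlongrightarrow> a) at_bot" "(v \<longlongrightarrow> 0) at_bot"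
    "\<And>t. t \<le> 0 \<Longrightarrow> z t \<le> z 0" "\<And>t. t \<le> 0 \<Longrightarrow> v t \<le> v 0 + d * (z 0 - a)"
proof -
  note z' = clamped_solutionD(1)[OF sol] and v' = clamped_solutionD(2)[OF sol]
  show z_le: "z t \<le> z 0" if "t \<le> 0" for t
    by (rule DERIV_nonneg_imp_nondecreasing[OF that, of z]) (use z' v in \<open>blast intro: less_imp_le\<close>)
  have clamp_z: "clamp (z t) = z t" if "t \<le> 0" for t
    using z[OF that] z_le[OF that] \<open>z 0 < b\<close> bm by (intro clamp_id) auto
  show v_le: "v t \<le> v 0 + d * (z 0 - a)" if "t \<le> 0" for t
  proof -
    \<comment> \<open>In the derivative of \<open>v + d * z\<close> the damping cancels, leaving
      \<open>- g (z t)\<close>, which is nonnegative on this side of the well.\<close>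
    have "v t + d * z t \<le> v 0 + d * z 0"
    proof (rule DERIV_nonneg_imp_nondecreasing[where f="\<lambda>t. v t + d * z t", OF that])
      fix s assume s: "t \<le> s" "s \<le> 0"
      have "((\<lambda>t. v t + d * z t) has_real_derivative - g (z s)) (at s)"
        using clamp_z[OF s(2)] by (auto intro!: derivative_eq_intros z' v')
      moreover have "g (z s) \<le> 0"
        using g_neg[OF z[OF s(2)]] z_le[OF s(2)] \<open>z 0 < b\<close> by simp
      ultimately show "\<exists>y. ((\<lambda>t. v t + d * z t) has_real_derivative y) (at s) \<and> 0 \<le> y"
        by (intro exI[of _ "- g (z s)"]) auto
    qed
    moreover have "d * a \<le> d * z t" using d z[OF that] by simp
    ultimately show ?thesis by (simp add: algebra_simps)
  qed
  have uminus': "(uminus has_real_derivative - 1) (at t)" for t :: real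
    by (auto intro!: derivative_eq_intros)
  have z'': "((\<lambda>t. z (- t)) has_real_derivative - v (- t)) (at t)" for t
    using DERIV_chain2[OF z' uminus', of t] by simp
  have v'': "((\<lambda>t. - v (- t)) has_real_derivative - g (z (- t)) - (- d) * - v (- t)) (at t)" if "0 \<le> t" for t
    using DERIV_minus[OF DERIV_chain2[OF v' uminus', of t]] clamp_z[of "- t"] that by (simp add: algebra_simps)
  have zero: "x = a" if "x \<in> {a..z 0}" "g x = 0" for x
    using that g_neg[of x] \<open>z 0 < b\<close> by fastforce
  have bounds: "z (- t) \<in> {a..z 0}" "\<bar>- v (- t)\<bar> \<le> v 0 + d * (z 0 - a)" if "0 \<le> t" for t
    using z[of "- t"] z_le[of "- t"] v[of "- t"] v_le[of "- t"] that by auto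
  have "- d \<noteq> 0" using d by simp
  note lim = damped_oscillator_limit[OF G g g' this compact_Icc zero z'' v'' bounds]
  have "((\<lambda>t. z (- t)) \<longlongrightarrow> a) at_top" "((\<lambda>t. - v (- t)) \<longlongrightarrow> 0) at_top"
    by (rule lim; assumption)+
  then show "(z \<longlongrightarrow> a) at_bot" "(v \<longlongrightarrow> 0) at_bot"
    using tendsto_minus_cancel_left[of "\<lambda>t. v (- t)" 0 at_top]
    by (auto simp: filterlim_at_bot_mirror)
qed

text \<open>At a first exit through \<open>a\<close> or \<open>m\<close> the potential alone would
  equal \<open>G a\<close>, more than the energy still available. The bounded energy also bounds the
  speed, and the limit lemma finishes.\<close>

lemma forward_limit:
  assumes sol: "clamped_solution z v" and z0: "a < z 0" "z 0 < m"
    and E0: "(v 0)\<^sup>2 / 2 + G (z 0) < G a"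
  shows "(z \<longlongrightarrow> b) at_top" "(v \<longlongrightarrow> 0) at_top" "\<And>t. 0 \<le> t \<Longrightarrow> a < z t \<and> z t < m"
    "\<exists>B. \<forall>t\<ge>0. \<bar>v t\<bar> \<le> B"
proof -
  note z' = clamped_solutionD(1)[OF sol] and v' = clamped_solutionD(2)[OF sol]
  note zc = clamped_solutionD(3)[OF sol] and vc = clamped_solutionD(4)[OF sol]
  define E where "E t = (v t)\<^sup>2 / 2 + G (z t)" for t
  have E_le: "E t \<le> E 0" if "0 \<le> t" "\<And>s. 0 \<le> s \<Longrightarrow> s \<le> t \<Longrightarrow> a \<le> z s \<and> z s \<le> m" for t
  proof (rule DERIV_nonpos_imp_nonincreasing[OF that(1), of E])
    fix s assume "0 \<le> s" "s \<le> t"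
    then have "(E has_real_derivative - d * (v s)\<^sup>2) (at s)"
      unfolding E_def using that(2) by (intro energy_deriv sol) auto
    then show "\<exists>y. (E has_real_derivative y) (at s) \<and> y \<le> 0"
      using d by (intro exI[of _ "- d * (v s)\<^sup>2"]) auto
  qed
  show inside: "a < z t \<and> z t < m" if "0 \<le> t" for t
  proof (rule ccontr)
    assume "\<not> ?thesis"
    then have le: "min (z t - a) (m - z t) \<le> 0" by auto
    have cont: "continuous_on {0..t} (\<lambda>t. min (z t - a) (m - z t))"
      by (intro continuous_intros zc)
    obtain r where r: "0 \<le> r" "r \<le> t" "min (z r - a) (m - z r) \<le> 0"
        "\<forall>u\<in>{0..<r}. 0 < min (z u - a) (m - z u)"
      by (rule obtain_first_nonpos[OF cont \<open>0 \<le> t\<close> le])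
    have "r \<noteq> 0" using r(3) z0 by auto
    then have "0 < r" using r(1) by simp
    have "\<forall>\<^sub>F u in at_left r. a \<le> z u" "\<forall>\<^sub>F u in at_left r. z u \<le> m"
      using \<open>0 < r\<close> r(4) by (auto intro!: eventually_at_leftI[of 0 r] less_imp_le)
    moreover have lim: "(z \<longlongrightarrow> z r) (at_left r)"
      using zc[of UNIV]
      by (auto simp: continuous_on_eq_continuous_at isCont_def intro: tendsto_mono[OF at_le])
    ultimately have zr: "a \<le> z r" "z r \<le> m"
      using tendsto_lowerbound[OF lim, of a] tendsto_upperbound[OF lim, of m] by auto
    have "a \<le> z s \<and> z s \<le> m" if "0 \<le> s" "s \<le> r" for s
      using bspec[OF r(4), of s] zr that by (cases "s = r") auto
    then have "E r < G a" using E_le[of r] \<open>0 < r\<close> E0 by (simp add: E_def)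
    moreover have "z r = a \<or> z r = m" using r(3) zr by auto
    then have "G (z r) = G a" using G_eq by auto
    ultimately show False by (simp add: E_def)
  qed
  have E_le': "E t \<le> E 0" if "0 \<le> t" for t
    using E_le[OF that] inside by (simp add: less_imp_le)
  \<comment> \<open>On \<open>{a..m}\<close> the force vanishes at both \<open>a\<close> and
    \<open>b\<close>; the energy bound \<open>E 0 < G a\<close> removes \<open>a\<close> and leaves
    \<open>b\<close> as the only zero.\<close>
  define C where "C = {x \<in> {a..m}. G x \<le> E 0}"
  have "closed C"
    unfolding C_def by (intro continuous_on_closed_Collect_le G_cont continuous_intros)
  moreover have "{a..m} \<inter> C = C" by (auto simp: C_def)
  ultimately have C: "compact C" using compact_Int_closed[OF compact_Icc[of a m], of C] by simp
  have zC: "z t \<in> C" if "0 \<le> t" for t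
    using inside[OF that] E_le'[OF that] by (auto simp: C_def E_def intro: order_trans[rotated])
  obtain \<beta> where \<beta>: "\<And>x. x \<in> {a..m} \<Longrightarrow> \<bar>G x\<bar> \<le> \<beta>"
    using compact_continuous_abs_bound[OF compact_Icc G_cont] by blast
  have vB: "\<bar>v t\<bar> \<le> sqrt (2 * (E 0 + \<beta>))" if "0 \<le> t" for t
    using E_le'[OF that] \<beta>[of "z t"] inside[OF that] by (intro real_le_rsqrt) (auto simp: E_def)
  then show "\<exists>B. \<forall>t\<ge>0. \<bar>v t\<bar> \<le> B" by blast
  have v'': "(v has_real_derivative - g (z t) - d * v t) (at t)" if "0 \<le> t" for t
    using v'[of t] inside[OF that] by (simp add: clamp_id)
  have zero: "x = b" if "x \<in> C" "g x = 0" for x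
  proof -
    have "x \<noteq> a" using that(1) E0 by (auto simp: C_def E_def)
    then show ?thesis
      using that g_neg[of x] g_pos[of x] by (cases x b rule: linorder_cases) (auto simp: C_def)
  qed
  have "d \<noteq> 0" using d by simp
  note lim = damped_oscillator_limit[OF G g g' this C zero z' v'' zC vB]
  show "(z \<longlongrightarrow> b) at_top" "(v \<longlongrightarrow> 0) at_top"
    by (rule lim; assumption)+
qed

theorem heteroclinic_exists: "\<exists>z v. heteroclinic z v"
proof -
  obtain c where c: "a < c" "c < b" using dense[OF ab] by blast
  obtain z v where sol: "clamped_solution z v" and z0: "z 0 = c"
      and z: "\<And>t. t \<le> 0 \<Longrightarrow> a < z t" and v: "\<And>t. t \<le> 0 \<Longrightarrow> 0 < v t"
    using backward_orbit_exists[OF c] by metis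
  have z0b: "z 0 < b" using c z0 by simp
  have bw: "(z \<longlongrightarrow> a) at_bot" "(v \<longlongrightarrow> 0) at_bot"
    "\<And>t. t \<le> 0 \<Longrightarrow> z t \<le> z 0" "\<And>t. t \<le> 0 \<Longrightarrow> v t \<le> v 0 + d * (z 0 - a)"
    using backward_limit[OF sol _ _ z0b] z v by auto
  define E where "E t = (v t)\<^sup>2 / 2 + G (z t)" for t
  have E': "(E has_real_derivative - d * (v t)\<^sup>2) (at t)" if "t \<le> 0" for t
    unfolding E_def using z[OF that] bw(3)[OF that] z0b bm
    by (intro energy_deriv sol) auto
  have neg: "- d * (v t)\<^sup>2 < 0" if "t \<le> 0" for t
    using d v[OF that] by simp
  \<comment> \<open>The limit at minus infinity gives only a weak inequality with
    \<open>G a\<close>; the strict loss of energy between times -1 and 0 makes it strict.\<close>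
  have "E 0 < E (- 1)"
    by (rule DERIV_neg_imp_decreasing[of "- 1" 0 E]) (auto intro!: exI E' neg simp del: mult_minus_left)
  also have "E (- 1) \<le> G a"
  proof (rule tendsto_lowerbound)
    have "isCont G a" using G DERIV_isCont by blast
    then have "(E \<longlongrightarrow> 0\<^sup>2 / 2 + G a) at_bot"
      unfolding E_def by (intro tendsto_intros isCont_tendsto_compose[of a G] bw) simp
    then show "(E \<longlongrightarrow> G a) at_bot" by simp
    show "\<forall>\<^sub>F t in at_bot. E (- 1) \<le> E t"
      using eventually_le_at_bot[of "- 1"]
    proof eventually_elim
      case (elim t)
      show ?case
      proof (rule DERIV_nonpos_imp_nonincreasing[OF elim, of E])
        fix s :: real assume "s \<le> - 1"
        then show "\<exists>y. (E has_real_derivative y) (at s) \<and> y \<le> 0"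
          using E'[of s] neg[of s] by (intro exI[of _ "- d * (v s)\<^sup>2"]) auto
      qed
    qed
  qed simp
  finally have E0: "(v 0)\<^sup>2 / 2 + G (z 0) < G a" by (simp add: E_def)
  have z0m: "a < z 0" "z 0 < m" using c z0 bm by auto
  note fw = forward_limit[OF sol z0m E0]
  have inside: "a < z t \<and> z t < m" for t
    using fw(3)[of t] z[of t] bw(3)[of t] z0m by (cases "0 \<le> t") auto
  obtain B where B: "\<And>t. 0 \<le> t \<Longrightarrow> \<bar>v t\<bar> \<le> B" using fw(4) by blast
  have "\<bar>v t\<bar> \<le> max B (v 0 + d * (z 0 - a))" for t
  proof (cases "0 \<le> t")
    case False
    then show ?thesis using v[of t] bw(4)[of t] by simp
  qed (use B[of t] in simp)
  then have "bounded (range v)" unfolding bounded_iff by auto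
  moreover have "(z has_real_derivative v t) (at t)" "(v has_real_derivative - g (z t) - d * v t) (at t)" for t
    using clamped_solutionD(1,2)[OF sol, of t] inside[of t] by (auto simp: clamp_id)
  ultimately have "heteroclinic z v"
    unfolding heteroclinic_def using inside fw(1,2) bw(1,2) by auto
  then show ?thesis by blast
qed

text \<open>Where \<open>g\<close> decreases, the difference of two solutions obeys a maximum principle: it has
  no negative interior minimum.\<close>

lemma solution_difference_nonneg:
  assumes "heteroclinic z v" "heteroclinic y u"
    and g_less: "\<And>x x'. a < x \<Longrightarrow> x < x' \<Longrightarrow> x' \<le> c \<Longrightarrow> g x' < g x"
    and z_le: "\<And>t. t \<le> p \<Longrightarrow> z t \<le> c" and y_le: "\<And>t. t \<le> q \<Longrightarrow> y t \<le> c"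
    and eq: "z p = y q" and "t \<le> 0"
  shows "y (t + q) \<le> z (t + p)"
proof (rule ccontr)
  assume neg: "\<not> y (t + q) \<le> z (t + p)"
  define w where "w s = z (s + p) - y (s + q)" for s
  define w' where "w' s = v (s + p) - u (s + q)" for s
  have z: "\<And>s. (z has_real_derivative v s) (at s)" "\<And>s. (v has_real_derivative - g (z s) - d * v s) (at s)"
      "(z \<longlongrightarrow> a) at_bot" "\<And>s. a < z s"
    and y: "\<And>s. (y has_real_derivative u s) (at s)" "\<And>s. (u has_real_derivative - g (y s) - d * u s) (at s)"
      "(y \<longlongrightarrow> a) at_bot" "\<And>s. a < y s"
    using assms(1,2) by (auto simp: heteroclinic_def)
  have w: "(w has_real_derivative w' s) (at s)" for s
    unfolding w_def w'_def by (intro DERIV_diff DERIV_shift[THEN iffD1] z y)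
  have w': "(w' has_real_derivative g (y (s + q)) - g (z (s + p)) - d * w' s) (at s)" for s
  proof -
    have "(w' has_real_derivative (- g (z (s + p)) - d * v (s + p)) - (- g (y (s + q)) - d * u (s + q))) (at s)"
      unfolding w'_def by (intro DERIV_diff DERIV_shift[THEN iffD1] z y)
    then show ?thesis by (simp add: w'_def algebra_simps)
  qed
  have shift: "filterlim (\<lambda>s. s + r) at_bot at_bot" for r :: real
    unfolding filterlim_at_bot
  proof
    fix Z :: real
    show "\<forall>\<^sub>F s in at_bot. s + r \<le> Z"
      using eventually_le_at_bot[of "Z - r"] by eventually_elim simp
  qed
  have "(w \<longlongrightarrow> a - a) at_bot"
    unfolding w_def by (intro tendsto_diff filterlim_compose[OF z(3) shift] filterlim_compose[OF y(3) shift])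
  then have "(w \<longlongrightarrow> 0) at_bot" by simp
  then have "\<forall>\<^sub>F s in at_bot. w t < w s"
    by (rule order_tendstoD(1)) (use neg in \<open>simp add: w_def\<close>)
  \<comment> \<open>The difference tends to 0 at minus infinity, hence exceeds its negative value
    \<open>w t\<close> up to \<open>T\<close>. As it vanishes at time 0, its minimum over
    \<open>{T..0}\<close> is interior.\<close>
  then obtain T where T: "\<And>s. s \<le> T \<Longrightarrow> w t < w s"
    unfolding eventually_at_bot_linorder by auto
  have "T < t" using T[of t] by (cases "t \<le> T") auto
  obtain r where r: "r \<in> {T..0}" "\<And>s. s \<in> {T..0} \<Longrightarrow> w r \<le> w s"
    using continuous_attains_inf[of "{T..0}" w] \<open>T < t\<close> \<open>t \<le> 0\<close> DERIV_continuous_on[of "{T..0}" w w'] w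
    by (force simp: has_field_derivative_at_within)
  have "w r \<le> w t" using r(2)[of t] \<open>T < t\<close> \<open>t \<le> 0\<close> by simp
  then have "w r < 0" using neg by (simp add: w_def)
  then have "r \<noteq> 0" using eq by (auto simp: w_def)
  moreover have "r \<noteq> T" using T[of T] \<open>w r \<le> w t\<close> by auto
  ultimately have r': "T < r" "r < 0" using r(1) by auto
  have "w' r = 0"
    by (rule DERIV_local_min[OF w, of "min (r - T) (0 - r)"]) (use r' r(2) in \<open>auto simp: abs_less_iff\<close>)
  \<comment> \<open>At the minimum \<open>z\<close> lies to the left of \<open>y\<close>, so the
    decreasing \<open>g\<close> makes the second derivative of \<open>w\<close> negative. Then
    \<open>w'\<close> is positive just before \<open>r\<close>, and \<open>w\<close> was smaller
    there, a contradiction.\<close>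
  moreover have "g (y (r + q)) < g (z (r + p))"
    using \<open>w r < 0\<close> r' y_le[of "r + q"] z(4) by (intro g_less) (auto simp: w_def)
  ultimately obtain e where e: "0 < e" "\<And>h. 0 < h \<Longrightarrow> h < e \<Longrightarrow> w' r < w' (r - h)"
    using DERIV_neg_dec_left[OF w'[of r]] by auto
  define h where "h = min e (r - T) / 2"
  have h: "0 < h" "h < e" "T \<le> r - h" using e(1) r' by (auto simp: h_def min_def field_simps)
  have "w (r - h) < w r"
  proof (rule DERIV_pos_imp_increasing_open[where f=w])
    show "r - h < r" using h by simp
    show "\<exists>k. (w has_real_derivative k) (at s) \<and> 0 < k" if "r - h < s" "s < r" for s
      using w[of s] e(2)[of "r - s"] that h \<open>w' r = 0\<close> by (intro exI[of _ "w' s"]) auto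
    show "continuous_on {r - h..r} w"
      using DERIV_continuous_on[of "{r - h..r}" w w'] w by (simp add: has_field_derivative_at_within)
  qed
  then show False using r(2)[of "r - h"] h r' by simp
qed

text \<open>The two orbits are matched in position at a common level close to the saddle. The
  comparison, applied in both directions, identifies their pasts, and uniqueness for the
  differential equation identifies them at all times.\<close>

theorem heteroclinic_unique:
  assumes zv: "heteroclinic z v" and yu: "heteroclinic y u"
  shows "\<exists>\<tau>. \<forall>t. y t = z (t + \<tau>) \<and> u t = v (t + \<tau>)"
proof -
  have "isCont g' a" using g' by (simp add: continuous_on_eq_continuous_at)
  then have "\<forall>\<^sub>F x in nhds a. g' x < 0"
    using g'a unfolding isCont_def tendsto_nhds_iff[symmetric]
    by (intro order_tendstoD) (auto simp: tendsto_at_iff_tendsto_nhds)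
  then obtain e where "0 < e" and e: "\<And>x. dist x a < e \<Longrightarrow> g' x < 0"
    unfolding eventually_nhds_metric by blast
  define c where "c = a + e / 2"
  have "a < c" using \<open>0 < e\<close> by (simp add: c_def)
  have g_less: "g x' < g x" if "a < x" "x < x'" "x' \<le> c" for x x'
    by (rule DERIV_neg_imp_decreasing[OF that(2), of g])
      (use that g e \<open>0 < e\<close> in \<open>force simp: c_def dist_real_def\<close>)
  note zc = clamped_solutionD(3)[OF heteroclinic_clamped_solution[OF zv]]
    and yc = clamped_solutionD(3)[OF heteroclinic_clamped_solution[OF yu]]
  have z: "(z \<longlongrightarrow> a) at_bot" "\<And>s. a < z s" and y: "(y \<longlongrightarrow> a) at_bot" "\<And>s. a < y s"
    using zv yu by (auto simp: heteroclinic_def)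
  have "\<forall>\<^sub>F s in at_bot. z s < c \<and> y s < c"
    using order_tendstoD(2)[OF z(1) \<open>a < c\<close>] order_tendstoD(2)[OF y(1) \<open>a < c\<close>] by eventually_elim simp
  then obtain T where T: "\<And>s. s \<le> T \<Longrightarrow> z s < c \<and> y s < c"
    unfolding eventually_at_bot_linorder by auto
  \<comment> \<open>The smaller of the two positions at \<open>T\<close> is a level that both orbits
    attain by time \<open>T\<close>, as both come from \<open>a < k\<close>.\<close>
  define k where "k = min (z T) (y T)"
  have hit: "\<exists>p\<le>T. x p = k" if "(x \<longlongrightarrow> a) at_bot" "continuous_on UNIV x" "k \<le> x T" for x
  proof -
    have "a < k" using z(2) y(2) by (simp add: k_def)
    then have "\<forall>\<^sub>F s in at_bot. x s < k \<and> s \<le> T"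
      using order_tendstoD(2)[OF that(1)] eventually_le_at_bot[of T] by (intro eventually_conj) auto
    then obtain S where S: "x S < k" "S \<le> T"
      using eventually_happens by fastforce
    show ?thesis
      using IVT'[of x S k T] S that(3) continuous_on_subset[OF that(2) subset_UNIV] by auto
  qed
  obtain p where p: "p \<le> T" "z p = k" using hit[OF z(1) zc] by (auto simp: k_def)
  obtain q where q: "q \<le> T" "y q = k" using hit[OF y(1) yc] by (auto simp: k_def)
  have zle: "z t \<le> c" if "t \<le> p" for t using T[of t] that p(1) by simp
  have yle: "y t \<le> c" if "t \<le> q" for t using T[of t] that q(1) by simp
  have eq: "z (t + p) = y (t + q)" if "t \<le> 0" for t
    using solution_difference_nonneg[OF zv yu g_less zle yle _ that]
      solution_difference_nonneg[OF yu zv g_less yle zle _ that] p q by force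
  \<comment> \<open>Positions agree for all \<open>t \<le> 0\<close>; the time -1 is interior to
    this half line, so the speeds agree there too and the full states coincide.\<close>
  have "v (- 1 + p) - u (- 1 + q) = 0"
  proof (rule DERIV_local_const[of "\<lambda>t. z (t + p) - y (t + q)" _ "- 1" 1])
    show "((\<lambda>t. z (t + p) - y (t + q)) has_real_derivative v (- 1 + p) - u (- 1 + q)) (at (- 1))"
      using zv yu unfolding heteroclinic_def by (intro DERIV_diff DERIV_shift[THEN iffD1]) auto
    show "\<forall>t. \<bar>- 1 - t\<bar> < 1 \<longrightarrow> z (- 1 + p) - y (- 1 + q) = z (t + p) - y (t + q)"
      using eq[of "- 1"] eq by (simp add: abs_less_iff)
  qed simp
  then have "y t = z (t + (p - q)) \<and> u t = v (t + (p - q))" for t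
    using clamped_solution_unique[OF heteroclinic_clamped_solution[OF yu] heteroclinic_clamped_solution[OF zv],
        where c="- 1 + q" and c'="- 1 + p" and t="t - (- 1 + q)"] eq[of "- 1"] by (simp add: algebra_simps)
  then show ?thesis by blast
qed

end

section \<open>The shock profile\<close>

context
  fixes \<zeta>l wl s :: real
  assumes \<zeta>l: "0 < \<zeta>l" and lax: "sqrt \<zeta>l + wl / \<zeta>l < s"
begin

section \<open>Algebra of the shock states\<close>

lemma K1_less: "K1 s \<zeta>l wl < - (\<zeta>l * sqrt \<zeta>l)"
proof -
  have "(sqrt \<zeta>l + wl / \<zeta>l) * \<zeta>l < s * \<zeta>l"
    using lax \<zeta>l by (rule mult_strict_right_mono)
  then show ?thesis using \<zeta>l by (simp add: K1_def algebra_simps)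
qed

lemma K1_neg: "K1 s \<zeta>l wl < 0"
proof -
  have "0 < \<zeta>l * sqrt \<zeta>l" using \<zeta>l by simp
  then show ?thesis using K1_less by linarith
qed

text \<open>The left Lax inequality in squared form. It makes the square root in
  \<open>\<zeta>r\<close> exceed \<open>3 * \<zeta>l\<close> and thus puts \<open>\<zeta>r\<close>
  to the right of \<open>\<zeta>l\<close>.\<close>

lemma K1_square_gt: "\<zeta>l ^ 3 < (K1 s \<zeta>l wl)\<^sup>2"
proof -
  have "(\<zeta>l * sqrt \<zeta>l)\<^sup>2 < (- K1 s \<zeta>l wl)\<^sup>2"
    using K1_less \<zeta>l by (intro power_strict_mono) auto
  moreover have "(\<zeta>l * sqrt \<zeta>l)\<^sup>2 = \<zeta>l\<^sup>2 * \<zeta>l"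
    using \<zeta>l by (simp add: power_mult_distrib)
  ultimately have "\<zeta>l\<^sup>2 * \<zeta>l < (K1 s \<zeta>l wl)\<^sup>2" by simp
  then show ?thesis by (simp add: power3_eq_cube power2_eq_square)
qed

lemma \<zeta>r_gt: "\<zeta>l < \<zeta>r s \<zeta>l wl"
proof -
  have "(3 * \<zeta>l)\<^sup>2 < (8 * (K1 s \<zeta>l wl)\<^sup>2 + \<zeta>l ^ 3) / \<zeta>l"
    using K1_square_gt \<zeta>l by (simp add: field_simps power3_eq_cube power2_eq_square)
  then have "3 * \<zeta>l < sqrt ((8 * (K1 s \<zeta>l wl)\<^sup>2 + \<zeta>l ^ 3) / \<zeta>l)"
    by (rule real_less_rsqrt)
  then show ?thesis by (simp add: \<zeta>r_def)
qed

text \<open>\<open>\<zeta>r\<close> is the positive root of the quadratic equation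
  \<open>\<zeta>l * x * (x + \<zeta>l) = 2 * K1\<^sup>2\<close>. Eliminating \<open>K1\<close> in
  favour of \<open>\<zeta>r\<close> removes the square root from the later identities.\<close>

lemma K1_square: "(K1 s \<zeta>l wl)\<^sup>2 = \<zeta>l * \<zeta>r s \<zeta>l wl * (\<zeta>r s \<zeta>l wl + \<zeta>l) / 2"
proof -
  have "(2 * \<zeta>r s \<zeta>l wl + \<zeta>l)\<^sup>2 = (8 * (K1 s \<zeta>l wl)\<^sup>2 + \<zeta>l ^ 3) / \<zeta>l"
    unfolding \<zeta>r_def using \<zeta>l by simp
  then have "\<zeta>l * (2 * \<zeta>r s \<zeta>l wl + \<zeta>l)\<^sup>2 = 8 * (K1 s \<zeta>l wl)\<^sup>2 + \<zeta>l ^ 3"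
    using \<zeta>l by (simp add: field_simps)
  then show ?thesis by (simp add: power2_eq_square power3_eq_cube algebra_simps)
qed

text \<open>With this and \<open>K1_square\<close>, the coefficients of \<open>F\<close> depend on
  \<open>\<zeta>l\<close> and \<open>\<zeta>r\<close> only, and the factorization follows by
  clearing denominators.\<close>

lemma K2_minus_sK1:
  "K2 s \<zeta>l wl - s * K1 s \<zeta>l wl = ((\<zeta>r s \<zeta>l wl)\<^sup>2 + \<zeta>l * \<zeta>r s \<zeta>l wl + \<zeta>l\<^sup>2) / 2"
proof -
  have "K2 s \<zeta>l wl - s * K1 s \<zeta>l wl = (K1 s \<zeta>l wl)\<^sup>2 / \<zeta>l + \<zeta>l\<^sup>2 / 2"
    using \<zeta>l by (simp add: K1_def K2_def field_simps power2_eq_square)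
  also have "(K1 s \<zeta>l wl)\<^sup>2 / \<zeta>l = \<zeta>r s \<zeta>l wl * (\<zeta>r s \<zeta>l wl + \<zeta>l) / 2"
    unfolding K1_square using \<zeta>l by simp
  finally show ?thesis by (simp add: field_simps power2_eq_square)
qed

lemma F_factor:
  assumes "0 < \<zeta>"
  shows "F s \<zeta>l wl \<zeta> = (\<zeta> - \<zeta>l) * (\<zeta> - \<zeta>r s \<zeta>l wl) * (\<zeta> + \<zeta>l + \<zeta>r s \<zeta>l wl) / (2 * \<zeta>\<^sup>2)"
  unfolding F_def K1_square K2_minus_sK1
  using assms by (simp add: field_simps power2_eq_square)

text \<open>Since \<open>wr / \<zeta>r = s + K1 / \<zeta>r\<close>, the claim amounts to
  \<open>- K1 < \<zeta>r * sqrt \<zeta>r\<close>. Squared, and with \<open>K1_square\<close>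
  inserted, it follows from \<open>\<zeta>l < \<zeta>r\<close>.\<close>

lemma lax_right: "s < wr s \<zeta>l wl / \<zeta>r s \<zeta>l wl + sqrt (\<zeta>r s \<zeta>l wl)"
proof -
  let ?R = "\<zeta>r s \<zeta>l wl"
  have R: "0 < ?R" "\<zeta>l < ?R" using \<zeta>r_gt \<zeta>l by auto
  have "(- K1 s \<zeta>l wl)\<^sup>2 < (?R * sqrt ?R)\<^sup>2"
  proof -
    have "\<zeta>l * ?R < ?R * ?R" using R by simp
    then have "\<zeta>l * ?R * (?R + \<zeta>l) < ?R * ?R * (?R + ?R)"
      by (rule mult_strict_mono) (use R \<zeta>l in auto)
    moreover have "(?R * sqrt ?R)\<^sup>2 = ?R * ?R * ?R"
      using R by (simp add: power_mult_distrib power2_eq_square[of ?R])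
    ultimately show ?thesis
      unfolding power2_minus K1_square by (simp add: algebra_simps)
  qed
  then have "- K1 s \<zeta>l wl < ?R * sqrt ?R"
    by (rule power2_less_imp_less) (use R in simp)
  then have "0 < K1 s \<zeta>l wl / ?R + sqrt ?R"
    using R by (simp add: field_simps)
  then show ?thesis
    using R by (simp add: wr_def add_divide_distrib)
qed

text \<open>In terms of \<open>exp x\<close> the force is a sum of exponentials, so its derivative
  and its potential are written down termwise. The signs of the force come from the factorization of
  \<open>F\<close>.\<close>

lemma damped_oscillator_shock:
  assumes "0 < d"
  shows "damped_oscillator
    (\<lambda>x. 3 / (K1 s \<zeta>l wl)\<^sup>2 * F s \<zeta>l wl (exp x))
    (\<lambda>x. 3 / (K1 s \<zeta>l wl)\<^sup>2 * (exp x / 2 - 2 * (K1 s \<zeta>l wl)\<^sup>2 * exp (- 2 * x) + (K2 s \<zeta>l wl - s * K1 s \<zeta>l wl) * exp (- x)))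
    (\<lambda>x. 3 / (K1 s \<zeta>l wl)\<^sup>2 * (exp x / 2 - (K1 s \<zeta>l wl)\<^sup>2 / 2 * exp (- 2 * x) + (K2 s \<zeta>l wl - s * K1 s \<zeta>l wl) * exp (- x)))
    d (ln \<zeta>l) (ln (\<zeta>r s \<zeta>l wl)) (ln ((K1 s \<zeta>l wl)\<^sup>2 / \<zeta>l\<^sup>2))"
proof -
  define k where "k = (K1 s \<zeta>l wl)\<^sup>2"
  define B where "B = K2 s \<zeta>l wl - s * K1 s \<zeta>l wl"
  define R where "R = \<zeta>r s \<zeta>l wl"
  have R: "\<zeta>l < R" "0 < R" using \<zeta>r_gt \<zeta>l by (auto simp: R_def)
  have k: "0 < k" using K1_neg by (simp add: k_def)
  have k_eq: "k = \<zeta>l * R * (R + \<zeta>l) / 2" using K1_square by (simp add: k_def R_def)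
  have B_eq: "B = (R\<^sup>2 + \<zeta>l * R + \<zeta>l\<^sup>2) / 2" using K2_minus_sK1 by (simp add: B_def R_def)
  have e2: "exp (- 2 * x) = exp (- x) * exp (- x)" for x :: real
    by (simp add: exp_add[symmetric])
  have F: "F s \<zeta>l wl (exp x) = exp x / 2 + k * exp (- 2 * x) - B * exp (- x)" for x
    unfolding F_def k_def[symmetric] B_def[symmetric] e2
    by (simp add: exp_minus power2_eq_square field_simps)
  have fac: "F s \<zeta>l wl (exp x) = (exp x - \<zeta>l) * (exp x - R) * (exp x + \<zeta>l + R) / (2 * (exp x)\<^sup>2)" for x
    using F_factor[of "exp x"] by (simp add: R_def)
  have e: "exp (ln \<zeta>l) = \<zeta>l" "exp (ln R) = R" "exp (- ln \<zeta>l) = 1 / \<zeta>l"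
    using R \<zeta>l by (simp_all add: exp_minus inverse_eq_divide)
  have km: "0 < k / \<zeta>l\<^sup>2" using k \<zeta>l by simp
  have em: "exp (ln (k / \<zeta>l\<^sup>2)) = k / \<zeta>l\<^sup>2" "exp (- ln (k / \<zeta>l\<^sup>2)) = \<zeta>l\<^sup>2 / k"
    using km by (simp_all add: exp_minus)
  show ?thesis
    unfolding k_def[symmetric] B_def[symmetric] R_def[symmetric]
  proof (unfold_locales, goal_cases)
    case (1 x)
    then show ?case unfolding F by (auto intro!: derivative_eq_intros simp: algebra_simps)
  next
    case (2 x)
    then show ?case unfolding F by (auto intro!: derivative_eq_intros simp: algebra_simps)
  next
    case 3
    then show ?case by (intro continuous_intros) simp
  next
    case 4
    then show ?case by (rule assms)
  next
    case 5
    then show ?case using R \<zeta>l by simp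
  next
    case 6
    \<comment> \<open>After inserting \<open>k_eq\<close>, the inequality
      \<open>R < k / \<zeta>l\<^sup>2\<close> says that
      \<open>2 * \<zeta>l < R + \<zeta>l\<close>.\<close>
    have "R * (2 * \<zeta>l) * \<zeta>l < R * (R + \<zeta>l) * \<zeta>l" using R \<zeta>l by simp
    then have "R < k / \<zeta>l\<^sup>2"
      unfolding k_eq using \<zeta>l by (simp add: field_simps power2_eq_square)
    then show ?case using R km by simp
  next
    case 7
    then show ?case using fac[of "ln \<zeta>l"] \<zeta>l by simp
  next
    case 8
    then show ?case using fac[of "ln R"] R by simp
  next
    case (9 x)
    then have "exp (ln \<zeta>l) < exp x" "exp x < exp (ln R)" by (auto intro: exp_less_mono)
    then have neg: "(exp x - \<zeta>l) * (exp x - R) * (exp x + \<zeta>l + R) < 0"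
      unfolding e using R \<zeta>l by (intro mult_neg_pos mult_pos_neg) auto
    show ?case unfolding fac using k by (intro mult_pos_neg divide_neg_pos[OF neg]) auto
  next
    case (10 x)
    have "exp (ln R) < exp x" using 10(1) by (rule exp_less_mono)
    then have "R < exp x" unfolding e .
    then have pos: "0 < (exp x - \<zeta>l) * (exp x - R) * (exp x + \<zeta>l + R)"
      using R \<zeta>l by (intro mult_pos_pos) auto
    show ?case unfolding fac using k by (intro mult_pos_pos divide_pos_pos[OF pos]) auto
  next
    case 11
    \<comment> \<open>With this form of \<open>B\<close>, and up to the factor \<open>3 / k\<close>,
      the potential equals \<open>\<zeta>l + k / (2 * \<zeta>l\<^sup>2)\<close> at both
      ends.\<close>
    have B_k: "B = k / \<zeta>l + \<zeta>l\<^sup>2 / 2"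
      unfolding k_eq B_eq using \<zeta>l by (simp add: field_simps power2_eq_square)
    show ?case
      unfolding e2 e em B_k using \<zeta>l k by (simp add: field_simps power2_eq_square)
  next
    case 12
    \<comment> \<open>The cubic in \<open>F\<close> has a simple zero at \<open>\<zeta>l\<close>,
      where the slope of the force has the sign of \<open>\<zeta>l - R\<close>.\<close>
    have "\<zeta>l / 2 - 2 * k * (1 / \<zeta>l * (1 / \<zeta>l)) + B * (1 / \<zeta>l) = (\<zeta>l - R) * (R + 2 * \<zeta>l) / (2 * \<zeta>l)"
      unfolding k_eq B_eq using \<zeta>l by (simp add: field_simps power2_eq_square)
    also have "\<dots> < 0"
      using R \<zeta>l by (intro divide_neg_pos mult_neg_pos) auto
    finally show ?case
      unfolding e2 e using k by (intro mult_pos_neg) auto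
  qed
qed

end

theorem theorem3p1:
  fixes \<delta> \<epsilon> \<zeta>l wl s :: real
  assumes "\<delta> > 0" and "\<epsilon> > 0" and "\<zeta>l > 0" and "s > 0"
    and "s > sqrt \<zeta>l + wl / \<zeta>l"
  shows "(\<exists>z v. connecting_solution \<delta> \<epsilon> s \<zeta>l wl z v \<and>
            (\<forall>z' v'. connecting_solution \<delta> \<epsilon> s \<zeta>l wl z' v' \<longrightarrow>
               (\<exists>\<xi>0. \<forall>\<xi>. z' \<xi> = z (\<xi> + \<xi>0) \<and> v' \<xi> = v (\<xi> + \<xi>0))))
         \<and> wl / \<zeta>l + sqrt \<zeta>l < s
         \<and> s < wr s \<zeta>l wl / \<zeta>r s \<zeta>l wl + sqrt (\<zeta>r s \<zeta>l wl)"
proof -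
  have "0 < 3 * c_const \<delta> \<epsilon> s / (K1 s \<zeta>l wl)\<^sup>2"
    using K1_neg[OF assms(3,5)] assms(1,2,4) by (simp add: c_const_def)
  then interpret damped_oscillator
    "\<lambda>x. 3 / (K1 s \<zeta>l wl)\<^sup>2 * F s \<zeta>l wl (exp x)"
    "\<lambda>x. 3 / (K1 s \<zeta>l wl)\<^sup>2 * (exp x / 2 - 2 * (K1 s \<zeta>l wl)\<^sup>2 * exp (- 2 * x) + (K2 s \<zeta>l wl - s * K1 s \<zeta>l wl) * exp (- x))"
    "\<lambda>x. 3 / (K1 s \<zeta>l wl)\<^sup>2 * (exp x / 2 - (K1 s \<zeta>l wl)\<^sup>2 / 2 * exp (- 2 * x) + (K2 s \<zeta>l wl - s * K1 s \<zeta>l wl) * exp (- x))"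
    "3 * c_const \<delta> \<epsilon> s / (K1 s \<zeta>l wl)\<^sup>2" "ln \<zeta>l" "ln (\<zeta>r s \<zeta>l wl)" "ln ((K1 s \<zeta>l wl)\<^sup>2 / \<zeta>l\<^sup>2)"
    by (rule damped_oscillator_shock[OF assms(3,5)])
  have tendsto_Pair_iff: "((\<lambda>\<xi>. (z \<xi>, v \<xi>)) \<longlongrightarrow> (x, y)) net \<longleftrightarrow> (z \<longlongrightarrow> x) net \<and> (v \<longlongrightarrow> y) net"
    for z v :: "real \<Rightarrow> real" and x y net
    by (auto intro: tendsto_Pair dest: tendsto_fst tendsto_snd)
  \<comment> \<open>Within \<open>M\<close> the position is bounded anyway, so boundedness of the
    orbit concerns the speed alone; the limits in the plane split into coordinates.\<close>
  have connecting_iff: "connecting_solution \<delta> \<epsilon> s \<zeta>l wl z v \<longleftrightarrow> heteroclinic z v" for z v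
  proof -
    have "bounded (range (\<lambda>\<xi>. (z \<xi>, v \<xi>))) \<longleftrightarrow> bounded (range v)"
      if z: "\<And>t. ln \<zeta>l < z t \<and> z t < ln ((K1 s \<zeta>l wl)\<^sup>2 / \<zeta>l\<^sup>2)"
    proof
      assume "bounded (range (\<lambda>\<xi>. (z \<xi>, v \<xi>)))"
      from bounded_snd[OF this] show "bounded (range v)" by (simp add: image_image)
    next
      assume "bounded (range v)"
      moreover have "bounded (range z)"
        by (intro bounded_subset[OF
              bounded_closed_interval[of "ln \<zeta>l" "ln ((K1 s \<zeta>l wl)\<^sup>2 / \<zeta>l\<^sup>2)"]])
          (use z in \<open>auto simp: less_imp_le\<close>)
      ultimately show "bounded (range (\<lambda>\<xi>. (z \<xi>, v \<xi>)))"
        by (intro bounded_subset[OF bounded_Times, of "range z" "range v"]) auto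
    qed
    then show ?thesis
      unfolding connecting_solution_def heteroclinic_def global_solution_def M_def tendsto_Pair_iff
      by auto
  qed
  obtain z v where "heteroclinic z v" using heteroclinic_exists by blast
  then have "\<exists>z v. connecting_solution \<delta> \<epsilon> s \<zeta>l wl z v \<and>
            (\<forall>z' v'. connecting_solution \<delta> \<epsilon> s \<zeta>l wl z' v' \<longrightarrow>
               (\<exists>\<xi>0. \<forall>\<xi>. z' \<xi> = z (\<xi> + \<xi>0) \<and> v' \<xi> = v (\<xi> + \<xi>0)))"
    unfolding connecting_iff using heteroclinic_unique by blast
  then show ?thesis
    using lax_right[OF assms(3,5)] assms(5) by (simp add: add.commute)
qed

end
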